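(* Let $\kappa\ge1$, $b\ge0$, $n\ge1$ be integers. Let $ss_{b,\kappa}(n)$ be the number of multiplex siteswaps of length $n$ using exactly $b$ balls in which at every beat at most $\kappa$ balls are thrown, and let $jp_{b,\kappa}(n)$ be the number of multiplex juggling patterns with exactly $b$ balls and minimal period $n$ in which at every beat at most $\kappa$ balls are thrown. Then \[ ss_{b,\kappa}(n)=\operatorname{trace}(A_{b,\kappa}^n)-\sum_{i=\max\{0,b-\kappa\}}^{b-1}\operatorname{trace}(A_{i,\kappa}^n), \] and \[ jp_{b,\kappa}(n)=\frac1n\sum_{d\mid n}\mu\!\left(\tfrac{n}{d}\right)\left(\operatorname{trace}(A_{b,\kappa}^d)-\sum_{i=\max\{0,b-\kappa\}}^{b-1}\operatorname{trace}(A_{i,\kappa}^d)\right), \] where $\mu$ is the M\"obius function.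
   Context: For an integer $b\ge 0$, an ordered partition of $b$ is a finite sequence $(q_1,\ldots,q_k)$ of positive integers summing to $b$ (for $b=0$ the only one is the empty sequence). An ordered partition $(q_1,\ldots,q_k)$ with $k\ge1$ is nontrivially embedded into an ordered partition $(r_1,\ldots,r_\ell)$ by a choice of indices $1\le i_2<\cdots<i_k\le \ell$ with $q_j\le r_{i_j}$ for $2\le j\le k$; different index tuples count as different embeddings. A card for $b$ balls is either (i) a trivial card, given by an ordered partition $q$ of $b$, with left and right partitions both $q$; or (ii) a throw card, given by ordered partitions $q$ ($k\ge1$ parts) and $r$ of $b$ together with a nontrivial embedding of $q$ into $r$, with left partition $q$ and right partition $r$. Different index tuples give different cards, and a throw card is distinct from the trivial card even when $q=r$. $A_b$ is the square matrix with rows and columns indexed by the ordered partitions of $b$ whose $(u,v)$ entry is the number of cards for $b$ balls with left partition $u$ and right partition $v$; $A_{b,\kappa}$ is the principal submatrix of $A_b$ on the rows and columns indexed by ordered partitions of $b$ all of whose parts are at most $\kappa$. A multiplex siteswap of length $n$ is a sequence $(M_0,\ldots,M_{n-1})$, indexed by $t\in\mathbb{Z}/n\mathbb{Z}$, of finite multisets of positive integers ($M_t$ is the multiset of throw heights at beat $t$, so $|M_t|$ balls are thrown at beat $t$) such that for every $t$, $|M_t|$ equals the number of pairs $(s,h)$ with $h$ an element of $M_s$ (with multiplicity) and $s+h\equiv t\pmod n$; its number of balls is $\frac1n\sum_t\sum_{h\in M_t}h$. Rotations are counted as different siteswaps. Its minimal period is the least $d\ge1$ with $M_{t+d}=M_t$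 for all $t$. A multiplex juggling pattern with $b$ balls and minimal period $n$ is an orbit, under cyclic rotation, of multiplex siteswaps of length $n$ with $b$ balls and minimal period $n$. *)

theory Defs
  imports "Jordan_Normal_Form.Matrix" "HOL-Library.Multiset"
    "HOL-Computational_Algebra.Squarefree" "HOL-Computational_Algebra.Primes"
begin

definition ord_partitions :: "nat \<Rightarrow> nat list set" where
  "ord_partitions b = {q. (\<forall>x\<in>set q. 0 < x) \<and> sum_list q = b}"

definition ord_partitions_bd :: "nat \<Rightarrow> nat \<Rightarrow> nat list set" where
  "ord_partitions_bd b \<kappa> = {q \<in> ord_partitions b. \<forall>x\<in>set q. x \<le> \<kappa>}"

(* nontrivial embeddings of q = (q_1,...,q_k), k>=1, into r = (r_1,...,r_l):
   strictly increasing index tuples (i_2,...,i_k) (here 0-based) with q_j <= r_{i_j};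
   list element j of the tuple corresponds to q!(j+1) *)
definition nontriv_embeddings :: "nat list \<Rightarrow> nat list \<Rightarrow> nat list set" where
  "nontriv_embeddings q r =
     (if q = [] then {} else
      {is. length is = length q - 1 \<and> sorted_wrt (<) is \<and> (\<forall>i\<in>set is. i < length r)
           \<and> (\<forall>j < length q - 1. q ! (j + 1) \<le> r ! (is ! j))})"

(* number of cards (b balls) with left partition u and right partition v:
   the trivial card (if u = v) plus one throw card per nontrivial embedding *)
definition num_cards :: "nat list \<Rightarrow> nat list \<Rightarrow> nat" where
  "num_cards u v = (if u = v then 1 else 0) + card (nontriv_embeddings u v)"

(* a fixed enumeration of the index set; the trace of powers does not depend on it *)
definition part_enum :: "nat \<Rightarrow> nat \<Rightarrow> nat list list" where
  "part_enum b \<kappa> = (SOME ps. distinct ps \<and> set ps = ord_partitions_bd b \<kappa>)"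

definition card_matrix :: "nat \<Rightarrow> nat \<Rightarrow> int mat" where
  "card_matrix b \<kappa> =
     (let ps = part_enum b \<kappa> in
      mat (length ps) (length ps) (\<lambda>(i, j). int (num_cards (ps ! i) (ps ! j))))"

definition mat_trace :: "'a::comm_monoid_add mat \<Rightarrow> 'a" where
  "mat_trace A = (\<Sum>i<dim_row A. A $$ (i, i))"

(* multiplex siteswaps of length n, represented as M :: nat => nat multiset with
   M t for t < n the multiset thrown at beat t and M t = {#} for t >= n *)
definition is_mss :: "nat \<Rightarrow> (nat \<Rightarrow> nat multiset) \<Rightarrow> bool" where
  "is_mss n M \<longleftrightarrow>
     (\<forall>t. n \<le> t \<longrightarrow> M t = {#}) \<and>
     (\<forall>t<n. \<forall>h\<in>#M t. 0 < h) \<and>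
     (\<forall>t<n. size (M t) = (\<Sum>s<n. size (filter_mset (\<lambda>h. (s + h) mod n = t) (M s))))"

definition mss_balls :: "nat \<Rightarrow> (nat \<Rightarrow> nat multiset) \<Rightarrow> nat \<Rightarrow> bool" where
  "mss_balls n M b \<longleftrightarrow> (\<Sum>t<n. sum_mset (M t)) = b * n"

definition siteswaps :: "nat \<Rightarrow> nat \<Rightarrow> nat \<Rightarrow> (nat \<Rightarrow> nat multiset) set" where
  "siteswaps b \<kappa> n = {M. is_mss n M \<and> mss_balls n M b \<and> (\<forall>t<n. size (M t) \<le> \<kappa>)}"

definition ss :: "nat \<Rightarrow> nat \<Rightarrow> nat \<Rightarrow> nat" where
  "ss b \<kappa> n = card (siteswaps b \<kappa> n)"

definition rot :: "nat \<Rightarrow> nat \<Rightarrow> (nat \<Rightarrow> nat multiset) \<Rightarrow> (nat \<Rightarrow> nat multiset)" where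
  "rot n k M = (\<lambda>t. if t < n then M ((t + k) mod n) else {#})"

definition min_period_is :: "nat \<Rightarrow> (nat \<Rightarrow> nat multiset) \<Rightarrow> bool" where
  "min_period_is n M \<longleftrightarrow> (\<forall>d. 1 \<le> d \<and> d < n \<longrightarrow> \<not> (\<forall>t<n. M ((t + d) mod n) = M t))"

definition rot_orbit :: "nat \<Rightarrow> (nat \<Rightarrow> nat multiset) \<Rightarrow> (nat \<Rightarrow> nat multiset) set" where
  "rot_orbit n M = {rot n k M | k. k < n}"

definition juggling_patterns :: "nat \<Rightarrow> nat \<Rightarrow> nat \<Rightarrow> (nat \<Rightarrow> nat multiset) set set" where
  "juggling_patterns b \<kappa> n =
     rot_orbit n ` {M \<in> siteswaps b \<kappa> n. min_period_is n M}"

definition jp :: "nat \<Rightarrow> nat \<Rightarrow> nat \<Rightarrow> nat" where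
  "jp b \<kappa> n = card (juggling_patterns b \<kappa> n)"

definition moebius :: "nat \<Rightarrow> int" where
  "moebius m = (if m = 0 then 0 else if squarefree m then (-1) ^ card (prime_factors m) else 0)"

end

theory Submission
  imports Defs
begin

text \<open>
  A throw card from \<open>u\<close> to \<open>v\<close> is the same thing as a list \<open>x \<le> v\<close> whose nonzero entries
  spell \<open>tl u\<close>: \<open>x\<close> records which part of each group of \<open>v\<close> was already in the air. So the trace
  of the \<open>n\<close>-th power counts \<open>n\<close>-periodic sequences of such cards. If the last group is left alone
  by every card, deleting it gives a closed walk with fewer balls, and the possible sizes of that
  group produce the subtracted sum. In every other closed walk all balls are eventually thrown: the
  part of the partition that is never reached cannot lose balls, and by periodicity it cannot gain
  any, so it would be an untouched tail. These walks correspond to periodic sequences of states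
  \<open>f t i\<close> (the number of balls that are in the air just before beat \<open>t\<close> and land at beat
  \<open>t + i\<close>): the partition is obtained by deleting the zeros of a state, and the landing times are
  recovered by recursion on \<open>i\<close>. Finally \<open>f (t + 1) i - f t (i + 1)\<close> is the number of throws of
  height \<open>i + 1\<close> at beat \<open>t\<close>, which matches state sequences with siteswaps. The shift acts on state
  sequences, so juggling patterns are counted by Moebius inversion.
\<close>

section \<open>Cards and closed walks\<close>

text \<open>
  The flag ``trivial or throw'' need not be recorded: for partitions of the same number the card is
  trivial iff \<open>x = v\<close>.
\<close>

definition steps :: "nat list \<Rightarrow> nat list \<Rightarrow> nat list set" where
  "steps u v = {x. list_all2 (\<le>) x v \<and>
     (x = v \<and> u = v \<or> u \<noteq> [] \<and> filter ((<) 0) x = tl u)}"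

section \<open>Throw cards as dominated lists\<close>

lemma sorted_filter_upt:
  assumes "sorted_wrt (<) is" "\<forall>i\<in>set is. i < (l::nat)"
  shows "filter (\<lambda>i. i \<in> set is) [0..<l] = is"
proof -
  have 1: "sorted_wrt (<) (filter (\<lambda>i. i \<in> set is) [0..<l])"
    by (rule sorted_wrt_filter) simp
  have 2: "set (filter (\<lambda>i. i \<in> set is) [0..<l]) = set is"
    using assms(2) by auto
  show ?thesis
    using 1 2 assms(1) by (metis sorted_list_of_set.idem_if_sorted_distinct strict_sorted_iff)
qed

text \<open>The index tuple is the support of \<open>x\<close> in increasing order, and the values
  of \<open>x\<close> on it spell \<open>tl q\<close>, so each determines the other. Positivity of
  the parts of \<open>q\<close> makes the support exactly the set of indices; \<open>tl\<close>
  reflects that the first part is thrown, not embedded.\<close>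

lemma bij_betw_embeddings:
  assumes "q \<noteq> []" "\<forall>a\<in>set q. 0 < a"
  shows "bij_betw (\<lambda>x. filter (\<lambda>j. 0 < x ! j) [0..<length r])
           {x. list_all2 (\<le>) x r \<and> filter ((<) 0) x = tl q} (nontriv_embeddings q r)"
    (is "bij_betw ?F ?X _")
proof -
  have vals: "map ((!) x) (?F x) = tl q" if "x \<in> ?X" for x
  proof -
    have "filter ((<) 0) (map ((!) x) [0..<length r]) = tl q"
      using that by (metis (mono_tags, lifting) list_all2_lengthD map_nth mem_Collect_eq)
    then show ?thesis by (simp add: filter_map o_def)
  qed
  have inj: "inj_on ?F ?X"
  proof (rule inj_onI)
    fix x y assume xX: "x \<in> ?X" and yX: "y \<in> ?X" and eq: "?F x = ?F y"
    have len: "length x = length r" "length y = length r"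
      using xX yX by (auto dest: list_all2_lengthD)
    have "map ((!) x) (?F x) = map ((!) y) (?F x)"
      using vals[OF xX] vals[OF yX] eq by simp
    then have agree: "x ! j = y ! j" if "j \<in> set (?F x)" for j
      using that by (simp only: map_eq_conv)
    have "x ! j = y ! j" if "j < length r" for j
    proof (cases "j \<in> set (?F x)")
      case True then show ?thesis by (rule agree)
    next
      case False
      then have "j \<notin> set (?F y)" using eq by simp
      with False that show ?thesis by simp
    qed
    then show "x = y" using len by (simp add: list_eq_iff_nth_eq)
  qed
  have "?F ` ?X = nontriv_embeddings q r"
  proof (intro equalityI subsetI)
    fix "is" assume "is \<in> ?F ` ?X"
    then obtain x where x: "x \<in> ?X" and is_def: "is = ?F x" by auto
    have len: "length x = length r" and le: "\<And>i. i < length r \<Longrightarrow> x ! i \<le> r ! i"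
      using x by (auto simp: list_all2_conv_all_nth)
    have v: "map ((!) x) is = tl q" using vals[OF x] is_def by simp
    then have l: "length is = length q - 1" by (metis length_map length_tl)
    have "q ! (j + 1) \<le> r ! (is ! j)" if "j < length q - 1" for j
    proof -
      have "q ! (j + 1) = tl q ! j" using that by (simp add: nth_tl)
      also have "\<dots> = x ! (is ! j)" using v l that by (metis nth_map)
      also have "is ! j < length r" using that l nth_mem[of j "is"] is_def by auto
      ultimately show ?thesis using le by simp
    qed
    moreover have "sorted_wrt (<) is" unfolding is_def by (rule sorted_wrt_filter) simp
    moreover have "\<forall>i\<in>set is. i < length r" by (auto simp: is_def)
    ultimately show "is \<in> nontriv_embeddings q r"
      using l assms(1) by (simp add: nontriv_embeddings_def)
  next
    fix "is" assume "is \<in> nontriv_embeddings q r"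
    then have l: "length is = length q - 1" and s: "sorted_wrt (<) is"
      and bd: "\<forall>i\<in>set is. i < length r"
      and le: "\<And>j. j < length q - 1 \<Longrightarrow> q ! (j + 1) \<le> r ! (is ! j)"
      using assms(1) by (auto simp: nontriv_embeddings_def)
    \<comment> \<open>\<open>g\<close> puts the part \<open>q ! (j + 1)\<close> at index
      \<open>is ! j\<close>, and 0 at the indices outside the tuple.\<close>
    define g where "g i = (case map_of (zip is (tl q)) i of None \<Rightarrow> 0 | Some a \<Rightarrow> a)" for i
    have dist: "distinct is" using s strict_sorted_iff by blast
    have g_nth: "g (is ! j) = q ! (j + 1)" if "j < length q - 1" for j
      using that l dist by (simp add: g_def map_of_zip_nth nth_tl)
    have g_out: "g i = 0" if "i \<notin> set is" for i
    proof -
      have "map_of (zip is (tl q)) i = None" using that l by (subst map_of_zip_is_None) auto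
      then show ?thesis by (simp add: g_def)
    qed
    have g_pos: "0 < g i" if i: "i \<in> set is" for i
    proof -
      obtain j where "j < length is" "i = is ! j" using i by (auto simp: in_set_conv_nth)
      then have "g i = q ! (j + 1)" "j + 1 < length q" using g_nth[of j] l by auto
      then show ?thesis using assms(2) nth_mem by metis
    qed
    have nz: "0 < g i \<longleftrightarrow> i \<in> set is" for i using g_out g_pos by fastforce
    define x where "x = map g [0..<length r]"
    have F: "?F x = is"
    proof -
      have "?F x = filter (\<lambda>i. i \<in> set is) [0..<length r]"
        by (rule filter_cong) (auto simp: x_def nz)
      then show ?thesis using sorted_filter_upt[OF s bd] by simp
    qed
    have "filter ((<) 0) x = map g (filter (\<lambda>i. i \<in> set is) [0..<length r])"
      by (simp add: x_def filter_map o_def nz)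
    also have "\<dots> = map g is" using sorted_filter_upt[OF s bd] by simp
    also have "\<dots> = tl q"
      by (rule nth_equalityI) (use l g_nth in \<open>simp_all add: nth_tl\<close>)
    finally have "filter ((<) 0) x = tl q" .
    moreover have "list_all2 (\<le>) x r"
    proof (rule list_all2_all_nthI)
      fix i assume "i < length x"
      then have i: "i < length r" by (simp add: x_def)
      show "x ! i \<le> r ! i"
      proof (cases "i \<in> set is")
        case True
        then obtain j where "j < length is" "i = is ! j" by (auto simp: in_set_conv_nth)
        then show ?thesis using g_nth[of j] le[of j] l i by (simp add: x_def)
      qed (use g_out i in \<open>simp add: x_def\<close>)
    qed (simp add: x_def)
    ultimately have "x \<in> ?X" by simp
    then show "is \<in> ?F ` ?X" using F by force
  qed
  with inj show ?thesis by (simp add: bij_betw_def)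
qed

lemma finite_list_all2_le: "finite {x. list_all2 (\<le>) x (v::nat list)}"
proof (rule finite_subset)
  show "{x. list_all2 (\<le>) x v} \<subseteq> {x. set x \<subseteq> {..sum_list v} \<and> length x = length v}"
  proof (clarsimp simp: list_all2_conv_all_nth in_set_conv_nth)
    fix x i assume "\<forall>i<length v. x ! i \<le> v ! i" "i < length v"
    then show "x ! i \<le> sum_list v"
      by (meson elem_le_sum_list le_trans)
  qed
qed (rule finite_lists_length_eq, simp)

lemma finite_steps: "finite (steps u v)"
  by (rule finite_subset[OF _ finite_list_all2_le[of v]]) (auto simp: steps_def)

text \<open>The two alternatives in \<open>steps\<close> never overlap: the parts of
  \<open>u\<close> are positive, so the filter returns \<open>u\<close> itself, which is longer than
  \<open>tl u\<close>.\<close>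

lemma card_steps:
  assumes "\<forall>a\<in>set u. 0 < a"
  shows "card (steps u v) = num_cards u v"
proof -
  let ?T = "{x. list_all2 (\<le>) x v \<and> u \<noteq> [] \<and> filter ((<) 0) x = tl u}"
  let ?I = "if u = v then {v} else {}"
  have refl: "list_all2 (\<le>) v v" by (simp add: list_all2_conv_all_nth)
  have "steps u v = ?I \<union> ?T" using refl by (auto simp: steps_def)
  moreover have "?I \<inter> ?T = {}"
  proof -
    have "filter ((<) 0) u \<noteq> tl u" if "u \<noteq> []"
      using assms that filter_True[of u "(<) 0"] by (metis list.collapse not_Cons_self2)
    then show ?thesis by auto
  qed
  moreover have "finite ?T"
    by (rule finite_subset[OF _ finite_list_all2_le[of v]]) auto
  ultimately have "card (steps u v) = card ?I + card ?T"
    by (simp add: card_Un_disjoint)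
  moreover have "card ?T = card (nontriv_embeddings u v)"
  proof (cases "u = []")
    case True then show ?thesis by (simp add: nontriv_embeddings_def)
  next
    case False
    then show ?thesis using bij_betw_same_card[OF bij_betw_embeddings[OF False assms, of v]] by simp
  qed
  ultimately show ?thesis by (simp add: num_cards_def)
qed

section \<open>Enumeration of partitions, walks and matrix powers\<close>

lemma length_le_sum_list: "\<forall>a\<in>set q. 0 < a \<Longrightarrow> length q \<le> sum_list (q::nat list)"
  by (induction q) (auto simp: Suc_le_eq add_strict_increasing)

lemma finite_ord_partitions_bd: "finite (ord_partitions_bd b \<kappa>)"
proof (rule finite_subset)
  show "ord_partitions_bd b \<kappa> \<subseteq> {q. set q \<subseteq> {..\<kappa>} \<and> length q \<le> b}"
    by (auto simp: ord_partitions_bd_def ord_partitions_def length_le_sum_list)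
qed (rule finite_lists_length_le, simp)

lemma part_enum: "distinct (part_enum b \<kappa>) \<and> set (part_enum b \<kappa>) = ord_partitions_bd b \<kappa>"
  unfolding part_enum_def
  by (rule someI_ex) (metis finite_distinct_list finite_ord_partitions_bd)

text \<open>The \<open>t\<close>-th entry of a walk holds the vertex at time \<open>t\<close> and the edge leaving it.\<close>

definition walks :: "'s set \<Rightarrow> ('s \<Rightarrow> 's \<Rightarrow> 'e set) \<Rightarrow> nat \<Rightarrow> 's \<Rightarrow> 's \<Rightarrow> ('s \<times> 'e) list set" where
  "walks S E n u w = (\<lambda>y. map y [0..<n]) `
     {y. fst (y 0) = u \<and> fst (y n) = w \<and>
         (\<forall>t<n. fst (y t) \<in> S \<and> snd (y t) \<in> E (fst (y t)) (fst (y (Suc t))))}"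

lemma walks_0: "walks S E 0 u w = (if u = w then {[]} else {})"
proof -
  have "\<exists>y. fst (y (0::nat)) = w" by (rule exI[of _ "\<lambda>_. (w, undefined)"]) simp
  then show ?thesis by (auto simp: walks_def)
qed

lemma walks_Suc:
  "walks S E (Suc n) u w = (\<Union>v\<in>S. (\<lambda>(ws, x). ws @ [(v, x)]) ` (walks S E n u v \<times> E v w))"
    (is "?L = ?R")
proof (intro equalityI subsetI)
  fix ws assume "ws \<in> ?L"
  then obtain y where y: "fst (y 0) = u" "fst (y (Suc n)) = w" "ws = map y [0..<Suc n]"
    "\<And>t. t < Suc n \<Longrightarrow> fst (y t) \<in> S \<and> snd (y t) \<in> E (fst (y t)) (fst (y (Suc t)))"
    by (auto simp: walks_def)
  have "map y [0..<n] \<in> walks S E n u (fst (y n))"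
    unfolding walks_def by (rule imageI) (use y in auto)
  moreover have "ws = map y [0..<n] @ [(fst (y n), snd (y n))]" using y(3) by simp
  moreover have "fst (y n) \<in> S" "snd (y n) \<in> E (fst (y n)) w" using y(2) y(4)[of n] by auto
  ultimately show "ws \<in> ?R" by force
next
  fix ws assume "ws \<in> ?R"
  then obtain v x ws' where v: "v \<in> S" "x \<in> E v w" "ws' \<in> walks S E n u v"
    and ws: "ws = ws' @ [(v, x)]" by auto
  then obtain y where y: "fst (y 0) = u" "fst (y n) = v" "ws' = map y [0..<n]"
    "\<And>t. t < n \<Longrightarrow> fst (y t) \<in> S \<and> snd (y t) \<in> E (fst (y t)) (fst (y (Suc t)))"
    by (auto simp: walks_def)
  \<comment> \<open>Only the vertex at time \<open>Suc n\<close> matters: the list stops at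
    \<open>n\<close>, so the edge stored there is arbitrary.\<close>
  define z where "z = y(n := (v, x), Suc n := (w, undefined))"
  have fst_z: "fst (z t) = fst (y t)" if "t \<le> n" for t using that y(2) by (auto simp: z_def)
  have zy: "z t = y t" if "t < n" for t using that by (simp add: z_def)
  have zn: "z n = (v, x)" and zS: "z (Suc n) = (w, undefined)" by (simp_all add: z_def)
  have "ws = map z [0..<Suc n]" using ws y(3) zy zn by simp
  moreover have "fst (z t) \<in> S \<and> snd (z t) \<in> E (fst (z t)) (fst (z (Suc t)))" if "t < Suc n" for t
  proof (cases "t = n")
    case True then show ?thesis using zn zS v by simp
  next
    case False
    then show ?thesis using that y(4)[of t] zy[of t] fst_z[of "Suc t"] by simp
  qed
  ultimately show "ws \<in> ?L"
    unfolding walks_def using y(1) fst_z[of 0] zS by force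
qed

lemma finite_walks:
  assumes "finite S" "\<And>u v. finite (E u v)"
  shows "finite (walks S E n u w)"
  by (induction n arbitrary: w) (auto simp: walks_0 walks_Suc assms)

lemma card_walks_Suc:
  assumes "finite S" "\<And>u v. finite (E u v)"
  shows "card (walks S E (Suc n) u w) = (\<Sum>v\<in>S. card (walks S E n u v) * card (E v w))"
proof -
  have "card (walks S E (Suc n) u w) =
    (\<Sum>v\<in>S. card ((\<lambda>(ws, x). ws @ [(v, x)]) ` (walks S E n u v \<times> E v w)))"
    unfolding walks_Suc
    by (rule card_UN_disjoint) (auto simp: assms finite_walks)
  also have "\<dots> = (\<Sum>v\<in>S. card (walks S E n u v \<times> E v w))"
    by (intro sum.cong refl card_image) (auto simp: inj_on_def)
  finally show ?thesis by (simp add: card_cartesian_product)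
qed

text \<open>Transfer-matrix argument: multiplication by \<open>A\<close> on the right appends a last
  edge, in step with \<open>card_walks_Suc\<close>.\<close>

lemma pow_mat_eq_card_walks:
  fixes ps :: "'s list"
  assumes "distinct ps" "\<And>u v. finite (E u v)" "i < length ps" "j < length ps"
  defines "A \<equiv> mat (length ps) (length ps) (\<lambda>(i, j). int (card (E (ps ! i) (ps ! j))))"
  shows "(A ^\<^sub>m n) $$ (i, j) = int (card (walks (set ps) E n (ps ! i) (ps ! j)))"
  using assms(4)
proof (induction n arbitrary: j)
  case 0
  then show ?case using assms(1,3) by (auto simp: walks_0 A_def nth_eq_iff_index_eq)
next
  case (Suc n)
  have A: "A \<in> carrier_mat (length ps) (length ps)" by (simp add: A_def)
  have An: "A ^\<^sub>m n \<in> carrier_mat (length ps) (length ps)" using A by simp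
  have "(A ^\<^sub>m Suc n) $$ (i, j) = (\<Sum>k<length ps. (A ^\<^sub>m n) $$ (i, k) * A $$ (k, j))"
    using A An assms(3) Suc.prems by (auto simp: scalar_prod_def atLeast0LessThan intro!: sum.cong)
  also have "\<dots> = (\<Sum>k<length ps. int (card (walks (set ps) E n (ps ! i) (ps ! k)) * card (E (ps ! k) (ps ! j))))"
    by (intro sum.cong refl) (use Suc in \<open>simp add: A_def\<close>)
  also have "\<dots> = int (\<Sum>v\<in>set ps. card (walks (set ps) E n (ps ! i) v) * card (E v (ps ! j)))"
    using sum.reindex_bij_betw[OF bij_betw_nth[OF assms(1) refl refl],
      of "\<lambda>v. int (card (walks (set ps) E n (ps ! i) v) * card (E v (ps ! j)))"] by simp
  finally show ?case by (simp add: card_walks_Suc assms(2))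
qed

definition periodic :: "nat \<Rightarrow> (nat \<Rightarrow> 'a) \<Rightarrow> bool" where
  "periodic n y \<longleftrightarrow> (\<forall>t. y (t + n) = y t)"

lemma periodic_mod: "periodic n y \<Longrightarrow> y (t mod n) = y t"
proof -
  assume p: "periodic n y"
  have "y (s + n * k) = y s" for s k
    by (induction k) (use p in \<open>simp_all add: periodic_def flip: add.assoc, metis add.assoc add.commute\<close>)
  then show ?thesis by (metis mod_mult_div_eq)
qed

text \<open>A closed walk is unrolled to a periodic function on all times, so that shifts and
  statements about every beat need no wrap-around.\<close>

definition closed_walks :: "'s set \<Rightarrow> ('s \<Rightarrow> 's \<Rightarrow> 'e set) \<Rightarrow> nat \<Rightarrow> (nat \<Rightarrow> 's \<times> 'e) set" where
  "closed_walks S E n = {y. periodic n y \<and>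
     (\<forall>t. fst (y t) \<in> S \<and> snd (y t) \<in> E (fst (y t)) (fst (y (Suc t))))}"

lemma bij_betw_closed_walks:
  assumes "0 < n"
  shows "bij_betw (\<lambda>y. map y [0..<n]) (closed_walks S E n) (\<Union>u\<in>S. walks S E n u u)"
proof -
  have "inj_on (\<lambda>y. map y [0..<n]) (closed_walks S E n)"
  proof (rule inj_onI, rule ext)
    fix y z t assume yz: "y \<in> closed_walks S E n" "z \<in> closed_walks S E n"
      and "map y [0..<n] = map z [0..<n]"
    then have "y (t mod n) = z (t mod n)" using assms by simp
    then show "y t = z t" using yz periodic_mod[of n y t] periodic_mod[of n z t]
      by (simp add: closed_walks_def)
  qed
  moreover have "map y [0..<n] \<in> (\<Union>u\<in>S. walks S E n u u)" if y: "y \<in> closed_walks S E n" for y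
  proof -
    have "\<forall>t. y (t + n) = y t" using y by (simp add: closed_walks_def periodic_def)
    then have "y n = y 0" by (metis add_0)
    then have "map y [0..<n] \<in> walks S E n (fst (y 0)) (fst (y 0))"
      unfolding walks_def by (intro imageI) (use y in \<open>simp add: closed_walks_def\<close>)
    then show ?thesis using y by (auto simp: closed_walks_def)
  qed
  moreover have "ws \<in> (\<lambda>y. map y [0..<n]) ` closed_walks S E n"
    if ws: "ws \<in> (\<Union>u\<in>S. walks S E n u u)" for ws
  proof -
    obtain y where y: "fst (y n) = fst (y 0)" "ws = map y [0..<n]"
      "\<And>t. t < n \<Longrightarrow> fst (y t) \<in> S \<and> snd (y t) \<in> E (fst (y t)) (fst (y (Suc t)))"
      using ws by (auto simp: walks_def)
    define z where "z t = y (t mod n)" for t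
    \<comment> \<open>At the end of a period this compares \<open>y 0\<close> with
      \<open>y n\<close>. Their vertices agree because the walk is closed; their edges may differ,
      hence the restriction to \<open>fst\<close>.\<close>
    have "fst (z (Suc t)) = fst (y (Suc (t mod n)))" for t
      using y(1) by (simp add: z_def mod_Suc)
    then have "z \<in> closed_walks S E n"
      using y(3) assms by (simp add: closed_walks_def periodic_def z_def)
    moreover have "ws = map z [0..<n]" using y(2) by (simp add: z_def)
    ultimately show ?thesis by blast
  qed
  ultimately show ?thesis unfolding bij_betw_def by blast
qed

lemma finite_closed_walks:
  assumes "0 < n" "finite S" "\<And>u v. finite (E u v)"
  shows "finite (closed_walks S E n)"
  using bij_betw_finite[OF bij_betw_closed_walks[OF assms(1), of S E]] assms by (simp add: finite_walks)

lemma card_closed_walks: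
  assumes "0 < n" "finite S" "\<And>u v. finite (E u v)"
  shows "card (closed_walks S E n) = (\<Sum>u\<in>S. card (walks S E n u u))"
proof -
  have "walks S E n u u \<inter> walks S E n v v = {}" if "u \<noteq> v" for u v
  proof -
    have "fst (hd ws) = u" if "ws \<in> walks S E n u u" for ws u
      using that assms(1) by (auto simp: walks_def hd_map)
    then show ?thesis using that by blast
  qed
  then have "card (\<Union>u\<in>S. walks S E n u u) = (\<Sum>u\<in>S. card (walks S E n u u))"
    by (intro card_UN_disjoint) (auto simp: assms finite_walks)
  then show ?thesis using bij_betw_same_card[OF bij_betw_closed_walks[OF assms(1), of S E]] by simp
qed

abbreviation card_walks :: "nat \<Rightarrow> nat \<Rightarrow> nat \<Rightarrow> (nat \<Rightarrow> nat list \<times> nat list) set" where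
  "card_walks b \<kappa> \<equiv> closed_walks (ord_partitions_bd b \<kappa>) steps"

lemma mat_trace_card_matrix:
  assumes "0 < n"
  shows "mat_trace (card_matrix b \<kappa> ^\<^sub>m n) = int (card (card_walks b \<kappa> n))"
proof -
  define ps where "ps = part_enum b \<kappa>"
  have ps: "distinct ps" "set ps = ord_partitions_bd b \<kappa>" using part_enum by (auto simp: ps_def)
  define A where "A = mat (length ps) (length ps) (\<lambda>(i, j). int (card (steps (ps ! i) (ps ! j))))"
  have "\<forall>a\<in>set (ps ! i). 0 < a" if "i < length ps" for i
    using that ps(2) nth_mem by (fastforce simp: ord_partitions_bd_def ord_partitions_def)
  then have A: "card_matrix b \<kappa> = A"
    by (intro eq_matI) (simp_all add: card_matrix_def A_def Let_def card_steps flip: ps_def)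
  have "mat_trace (A ^\<^sub>m n) = (\<Sum>i<length ps. int (card (walks (set ps) steps n (ps ! i) (ps ! i))))"
    unfolding mat_trace_def
    by (intro sum.cong)
      (use pow_mat_eq_card_walks[OF ps(1) finite_steps] in \<open>simp_all add: A_def\<close>)
  also have "\<dots> = int (\<Sum>u\<in>set ps. card (walks (set ps) steps n u u))"
    using sum.reindex_bij_betw[OF bij_betw_nth[OF ps(1) refl refl],
      of "\<lambda>u. int (card (walks (set ps) steps n u u))"] by simp
  also have "\<dots> = int (card (card_walks b \<kappa> n))"
    using card_closed_walks[OF assms, of "set ps" steps] finite_steps by (simp add: ps(2) finite_ord_partitions_bd)
  finally show ?thesis using A by simp
qed

section \<open>Walks with an untouched last group\<close>

text \<open>\<open>snd (y t)\<close> lists the old balls in the groups of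
  \<open>fst (y (Suc t))\<close>, so equal last entries mean that no ball is thrown into the last
  group. Nonemptiness keeps out the unspecified \<open>last []\<close>.\<close>

definition untouched :: "(nat \<Rightarrow> nat list \<times> nat list) \<Rightarrow> bool" where
  "untouched y \<longleftrightarrow> (\<forall>t. fst (y t) \<noteq> [] \<and> last (snd (y t)) = last (fst (y (Suc t))))"

definition full_walks :: "nat \<Rightarrow> nat \<Rightarrow> nat \<Rightarrow> (nat \<Rightarrow> nat list \<times> nat list) set" where
  "full_walks b \<kappa> n = {y \<in> card_walks b \<kappa> n. \<not> untouched y}"

text \<open>Sorts the untouched walks by the size \<open>j\<close> of the last group, in a form in
  which that group can be deleted at all times at once.\<close>

definition tail_walks :: "nat \<Rightarrow> nat \<Rightarrow> nat \<Rightarrow> nat \<Rightarrow> (nat \<Rightarrow> nat list \<times> nat list) set" where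
  "tail_walks b \<kappa> n j = {y \<in> card_walks b \<kappa> n.
     \<forall>t. fst (y t) \<noteq> [] \<and> snd (y t) \<noteq> [] \<and> last (fst (y t)) = j \<and> last (snd (y t)) = j}"

text \<open>As \<open>0 < j\<close>, the appended entry survives the filter. For
  \<open>u = []\<close> the throw alternative therefore fails on both sides, since
  \<open>tl [j]\<close> is empty.\<close>

lemma append_mem_steps_iff:
  assumes "0 < j"
  shows "x @ [j] \<in> steps (u @ [j]) (v @ [j]) \<longleftrightarrow> x \<in> steps u v"
proof -
  have le: "list_all2 (\<le>) (x @ [j]) (v @ [j]) \<longleftrightarrow> list_all2 (\<le>) x v"
    by (cases "length x = length v") (auto simp: list_all2_append dest: list_all2_lengthD)
  show ?thesis using assms by (cases u) (auto simp: steps_def le)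
qed

lemma append_mem_ord_partitions_bd_iff:
  assumes "0 < j" "j \<le> \<kappa>" "j \<le> b"
  shows "q @ [j] \<in> ord_partitions_bd b \<kappa> \<longleftrightarrow> q \<in> ord_partitions_bd (b - j) \<kappa>"
  using assms by (auto simp: ord_partitions_bd_def ord_partitions_def)

lemma bij_betw_tail_walks:
  assumes "0 < j" "j \<le> \<kappa>" "j \<le> b"
  shows "bij_betw (\<lambda>y t. (fst (y t) @ [j], snd (y t) @ [j]))
           (card_walks (b - j) \<kappa> n) (tail_walks b \<kappa> n j)"
proof (rule bij_betwI[where g = "\<lambda>y t. (butlast (fst (y t)), butlast (snd (y t)))"])
  show "(\<lambda>y t. (fst (y t) @ [j], snd (y t) @ [j])) \<in> card_walks (b - j) \<kappa> n \<rightarrow> tail_walks b \<kappa> n j"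
    using assms
    by (auto simp: tail_walks_def closed_walks_def periodic_def append_mem_steps_iff
        append_mem_ord_partitions_bd_iff)
  show "(\<lambda>y t. (butlast (fst (y t)), butlast (snd (y t)))) \<in> tail_walks b \<kappa> n j \<rightarrow> card_walks (b - j) \<kappa> n"
  proof
    fix y assume y: "y \<in> tail_walks b \<kappa> n j"
    then have eq: "fst (y t) = butlast (fst (y t)) @ [j]" "snd (y t) = butlast (snd (y t)) @ [j]" for t
      using append_butlast_last_id[of "fst (y t)"] append_butlast_last_id[of "snd (y t)"]
      by (auto simp: tail_walks_def)
    have "butlast (fst (y t)) \<in> ord_partitions_bd (b - j) \<kappa>" for t
      using y eq(1)[of t] append_mem_ord_partitions_bd_iff[OF assms, of "butlast (fst (y t))"]
      by (simp add: tail_walks_def closed_walks_def)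
    moreover have "butlast (snd (y t)) \<in> steps (butlast (fst (y t))) (butlast (fst (y (Suc t))))" for t
      using y eq(2)[of t] eq(1)[of t] eq(1)[of "Suc t"] append_mem_steps_iff[OF assms(1),
          of "butlast (snd (y t))" "butlast (fst (y t))" "butlast (fst (y (Suc t)))"]
      by (simp add: tail_walks_def closed_walks_def)
    ultimately show "(\<lambda>t. (butlast (fst (y t)), butlast (snd (y t)))) \<in> card_walks (b - j) \<kappa> n"
      using y by (auto simp: tail_walks_def closed_walks_def periodic_def)
  qed
  fix y assume y: "y \<in> tail_walks b \<kappa> n j"
  show "(\<lambda>t. (fst (butlast (fst (y t)), butlast (snd (y t))) @ [j],
               snd (butlast (fst (y t)), butlast (snd (y t))) @ [j])) = y"
  proof
    fix t
    show "(fst (butlast (fst (y t)), butlast (snd (y t))) @ [j],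
        snd (butlast (fst (y t)), butlast (snd (y t))) @ [j]) = y t"
      using y append_butlast_last_id[of "fst (y t)"] append_butlast_last_id[of "snd (y t)"]
      by (simp add: tail_walks_def prod_eq_iff)
  qed
qed simp

lemma last_filter: "x \<noteq> [] \<Longrightarrow> P (last x) \<Longrightarrow> filter P x \<noteq> [] \<and> last (filter P x) = last x"
  by (cases x rule: rev_cases) auto

text \<open>A positive last entry survives the filter, so it ends \<open>tl u\<close> and hence
  \<open>u\<close>; in the trivial case \<open>x = u\<close>.\<close>

lemma step_last:
  assumes "x \<in> steps u v" "x \<noteq> []" "0 < last x"
  shows "last x = last u"
  using assms last_filter[of x "(<) 0"] unfolding steps_def
  by (cases u) auto

text \<open>By \<open>step_last\<close> the last group of an untouched walk keeps its size
  \<open>j\<close>. The bounds \<open>0 < j\<close>, \<open>j \<le> \<kappa>\<close> and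
  \<open>j \<le> b\<close> say that \<open>i = b - j\<close> runs through the stated range, whose
  truncated lower end is the maximum with 0.\<close>

lemma untouched_walks_eq:
  "{y \<in> card_walks b \<kappa> n. untouched y} = (\<Union>i\<in>{b - \<kappa>..<b}. tail_walks b \<kappa> n (b - i))"
proof (intro equalityI subsetI)
  fix y assume y: "y \<in> {y \<in> card_walks b \<kappa> n. untouched y}"
  define j where "j = last (fst (y 0))"
  have pt: "fst (y t) \<in> ord_partitions_bd b \<kappa>" and st: "snd (y t) \<in> steps (fst (y t)) (fst (y (Suc t)))"
    and ne: "fst (y t) \<noteq> []" and lst: "last (snd (y t)) = last (fst (y (Suc t)))" for t
    using y by (auto simp: closed_walks_def untouched_def)
  have ne': "snd (y t) \<noteq> []" for t
    using st[of t] ne[of "Suc t"] by (auto simp: steps_def)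
  have bd: "0 < last (fst (y t)) \<and> last (fst (y t)) \<le> \<kappa> \<and> last (fst (y t)) \<le> b" for t
    using pt[of t] last_in_set[OF ne[of t]] member_le_sum_list[of "last (fst (y t))" "fst (y t)"]
    by (auto simp: ord_partitions_bd_def ord_partitions_def)
  have "last (snd (y t)) = last (fst (y t))" for t
    using step_last[OF st ne'] lst bd by simp
  moreover have "last (fst (y t)) = j" for t
    by (induction t) (use calculation lst in \<open>simp_all add: j_def\<close>)
  ultimately have "y \<in> tail_walks b \<kappa> n j"
    using y ne ne' by (simp add: tail_walks_def)
  moreover have "b - j \<in> {b - \<kappa>..<b}" "b - (b - j) = j" using bd[of 0] by (auto simp: j_def)
  ultimately show "y \<in> (\<Union>i\<in>{b - \<kappa>..<b}. tail_walks b \<kappa> n (b - i))" by force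
qed (auto simp: tail_walks_def untouched_def)

lemma card_full_walks:
  assumes "0 < n"
  shows "int (card (full_walks b \<kappa> n)) = int (card (card_walks b \<kappa> n))
           - (\<Sum>i = b - \<kappa>..<b. int (card (card_walks i \<kappa> n)))"
proof -
  have fin: "finite (card_walks b \<kappa> n)"
    using assms by (simp add: finite_closed_walks finite_ord_partitions_bd finite_steps)
  let ?U = "{y \<in> card_walks b \<kappa> n. untouched y}"
  have "card_walks b \<kappa> n = full_walks b \<kappa> n \<union> ?U" by (auto simp: full_walks_def)
  moreover have "card (full_walks b \<kappa> n \<union> ?U) = card (full_walks b \<kappa> n) + card ?U"
    by (rule card_Un_disjoint) (use fin in \<open>auto simp: full_walks_def\<close>)
  moreover have "card ?U = (\<Sum>i = b - \<kappa>..<b. card (tail_walks b \<kappa> n (b - i)))"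
    unfolding untouched_walks_eq
  proof (rule card_UN_disjoint)
    show "\<forall>i\<in>{b - \<kappa>..<b}. finite (tail_walks b \<kappa> n (b - i))"
      using fin by (auto simp: tail_walks_def)
    show "\<forall>i\<in>{b - \<kappa>..<b}. \<forall>j\<in>{b - \<kappa>..<b}. i \<noteq> j \<longrightarrow>
        tail_walks b \<kappa> n (b - i) \<inter> tail_walks b \<kappa> n (b - j) = {}"
      by (fastforce simp: tail_walks_def)
  qed simp
  moreover have "card (tail_walks b \<kappa> n (b - i)) = card (card_walks i \<kappa> n)" if "i \<in> {b - \<kappa>..<b}" for i
    using bij_betw_same_card[OF bij_betw_tail_walks[of "b - i" \<kappa> b n]] that by auto
  ultimately show ?thesis by simp
qed

section \<open>State sequences\<close>

text \<open>Balls in the air keep their landing beat, so they reappear one index lower and only new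
  throws are added. The entry \<open>f t 0\<close> counts the balls thrown at beat \<open>t\<close>,
  whence the bound \<open>\<kappa>\<close> on it alone. A single \<open>H\<close> bounds the landing
  times for all \<open>t\<close>.\<close>

definition state_seqs :: "nat \<Rightarrow> nat \<Rightarrow> (nat \<Rightarrow> nat \<Rightarrow> nat) set" where
  "state_seqs b \<kappa> = {f. (\<forall>t i. f t (Suc i) \<le> f (Suc t) i) \<and> (\<forall>t. f t 0 \<le> \<kappa>) \<and>
     (\<exists>H. \<forall>t. (\<forall>i\<ge>H. f t i = 0) \<and> (\<Sum>i<H. f t i) = b)}"

lemma state_seqsD:
  assumes "f \<in> state_seqs b \<kappa>"
  shows "\<exists>H. \<forall>t. (\<forall>i\<ge>H. f t i = 0) \<and> (\<Sum>i<H. f t i) = b"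
    and "f t (Suc i) \<le> f (Suc t) i" and "f t 0 \<le> \<kappa>"
  using assms by (simp_all add: state_seqs_def)

text \<open>The landing times of the groups in order: entry \<open>c\<close> belongs to group
  \<open>c\<close> of the partition.\<close>

definition posn :: "(nat \<Rightarrow> nat) \<Rightarrow> nat list" where
  "posn g = sorted_list_of_set {i. 0 < g i}"

lemma set_posn:
  assumes "\<forall>i\<ge>H. g i = 0"
  shows "set (posn g) = {i. 0 < g i}"
proof -
  have "i < H" if "0 < g i" for i using assms that by (metis leI less_irrefl)
  then have "finite {i. 0 < g i}" by (auto intro: finite_subset[of _ "{..<H}"])
  then show ?thesis by (simp add: posn_def)
qed

lemma posn_eq:
  assumes "\<forall>i\<ge>H. g i = 0"
  shows "posn g = filter (\<lambda>i. 0 < g i) [0..<H]"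
proof -
  have "i < H" if "0 < g i" for i using assms that by (metis leI less_irrefl)
  then have "{i. 0 < g i} = set (filter (\<lambda>i. 0 < g i) [0..<H])" by auto
  then show ?thesis
    unfolding posn_def
    by (metis (no_types, lifting) distinct_filter distinct_upt sorted_list_of_set.idem_if_sorted_distinct
        sorted_upt sorted_wrt_filter)
qed

text \<open>A group is found at the rank of its landing time, that is, the number of occupied times
  before it. Decoding uses this rank to index cards.\<close>

lemma posn_nth:
  assumes "\<forall>i\<ge>H. g i = 0" "0 < g i"
  defines "c \<equiv> length (filter (\<lambda>j. 0 < g j) [0..<i])"
  shows "c < length (posn g)" "posn g ! c = i"
proof -
  have "i < H" using assms by (metis not_le less_irrefl)
  then have "[0..<H] = [0..<i] @ i # [Suc i..<H]"
    using upt_add_eq_append[of 0 i "H - i"] by (simp add: upt_conv_Cons)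
  then have "posn g = filter (\<lambda>j. 0 < g j) [0..<i] @ i # filter (\<lambda>j. 0 < g j) [Suc i..<H]"
    using posn_eq[OF assms(1)] assms(2) by simp
  then show "c < length (posn g)" "posn g ! c = i" by (simp_all add: c_def)
qed

lemma sum_list_posn:
  assumes "\<forall>i\<ge>H. g i = 0"
  shows "sum_list (map g (posn g)) = (\<Sum>i<H. g i)"
proof -
  have "sum_list (map g (posn g)) = sum_list (map g [0..<H])"
    unfolding posn_eq[OF assms] by (rule sum_list_map_filter) simp
  then show ?thesis by (simp add: interv_sum_list_conv_sum_set_nat atLeast0LessThan)
qed

text \<open>The card is indexed by the groups of the state at \<open>Suc t\<close>; the group
  landing at index \<open>i\<close> there contains \<open>f t (Suc i)\<close> balls that were
  already in the air.\<close>

definition walk_of :: "(nat \<Rightarrow> nat \<Rightarrow> nat) \<Rightarrow> nat \<Rightarrow> nat list \<times> nat list" where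
  "walk_of f t = (map (f t) (posn (f t)), map (\<lambda>i. f t (Suc i)) (posn (f (Suc t))))"

text \<open>
  The first component is the state entry \<open>f t i\<close>, the second the number of nonzero entries before it,
  that is, the index of the corresponding group.
\<close>

primrec decode :: "(nat \<Rightarrow> nat list \<times> nat list) \<Rightarrow> nat \<Rightarrow> nat \<Rightarrow> nat \<times> nat" where
  "decode y 0 = (\<lambda>t. (if snd (y t) = fst (y (Suc t)) then 0 else hd (fst (y t)), 0))"
| "decode y (Suc i) = (\<lambda>t.
     (if 0 < fst (decode y i (Suc t)) then snd (y t) ! snd (decode y i (Suc t)) else 0,
      snd (decode y i t) + (if 0 < fst (decode y i t) then 1 else 0)))"

definition state_of :: "(nat \<Rightarrow> nat list \<times> nat list) \<Rightarrow> nat \<Rightarrow> nat \<Rightarrow> nat" where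
  "state_of y t i = fst (decode y i t)"

section \<open>Recovering a state sequence from its walk\<close>

lemma snd_decode: "snd (decode y i t) = length (filter (\<lambda>j. 0 < state_of y t j) [0..<i])"
  by (induction i) (auto simp: state_of_def)

lemma state_of_0: "state_of y t 0 = (if snd (y t) = fst (y (Suc t)) then 0 else hd (fst (y t)))"
  by (simp add: state_of_def)

lemma state_of_Suc:
  "state_of y t (Suc i) = (if 0 < state_of y (Suc t) i
     then snd (y t) ! length (filter (\<lambda>j. 0 < state_of y (Suc t) j) [0..<i]) else 0)"
  by (simp add: state_of_def snd_decode[unfolded state_of_def])

text \<open>Conservation of balls: \<open>f t 0\<close> is the sum over \<open>i\<close> of the gaps
  \<open>f (Suc t) i - f t (Suc i)\<close>, none of which is negative.\<close>

lemma state_0_eq_0_iff: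
  assumes "f \<in> state_seqs b \<kappa>"
  shows "f t 0 = 0 \<longleftrightarrow> (\<forall>i. f t (Suc i) = f (Suc t) i)"
proof -
  obtain H where H': "\<forall>t. (\<forall>i\<ge>H. f t i = 0) \<and> (\<Sum>i<H. f t i) = b"
    using state_seqsD(1)[OF assms] by blast
  then have H: "\<And>t i. H \<le> i \<Longrightarrow> f t i = 0" "\<And>t. (\<Sum>i<H. f t i) = b" by auto
  note le = state_seqsD(2)[OF assms]
  have "(\<Sum>i<H. f (Suc t) i) = (\<Sum>i<Suc H. f t i)" using H by simp
  then have sums: "(\<Sum>i<H. f (Suc t) i) = f t 0 + (\<Sum>i<H. f t (Suc i))"
    by (simp only: sum.lessThan_Suc_shift)
  have "f t (Suc i) = f (Suc t) i" if "f t 0 = 0" for i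
  proof (cases "i < H")
    case True
    then show ?thesis
      using sum_mono_inv[of "\<lambda>i. f t (Suc i)" "{..<H}" "f (Suc t)" i] sums that le by auto
  qed (use H in simp)
  then show ?thesis using sums by auto
qed

text \<open>The card compares only the occupied positions of the next state, but at the others
  \<open>f t (Suc i)\<close> is 0 as well. This is the test for a throw in the first clause of
  \<open>decode\<close>.\<close>

lemma walk_of_throw_iff:
  assumes "f \<in> state_seqs b \<kappa>"
  shows "snd (walk_of f t) = fst (walk_of f (Suc t)) \<longleftrightarrow> f t 0 = 0"
proof -
  obtain H where H': "\<forall>t. (\<forall>i\<ge>H. f t i = 0) \<and> (\<Sum>i<H. f t i) = b"
    using state_seqsD(1)[OF assms] by blast
  then have H: "\<And>t i. H \<le> i \<Longrightarrow> f t i = 0" and Hs: "\<And>t. (\<Sum>i<H. f t i) = b" by auto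
  note le = state_seqsD(2)[OF assms]
  have set: "set (posn (f (Suc t))) = {i. 0 < f (Suc t) i}"
    using set_posn[of H] H by simp
  have "snd (walk_of f t) = fst (walk_of f (Suc t)) \<longleftrightarrow>
      (\<forall>i. 0 < f (Suc t) i \<longrightarrow> f t (Suc i) = f (Suc t) i)"
    by (simp add: walk_of_def set)
  also have "\<dots> \<longleftrightarrow> (\<forall>i. f t (Suc i) = f (Suc t) i)"
    using le by (metis bot_nat_0.not_eq_extremum le_zero_eq)
  finally show ?thesis using state_0_eq_0_iff[OF assms] by simp
qed

text \<open>Every group of the state at \<open>t\<close> other than the one at index 0 sits where
  the next state is occupied too, so it shows up as a nonzero card entry.\<close>

lemma fst_walk_of:
  assumes "f \<in> state_seqs b \<kappa>"
  shows "fst (walk_of f t) = (if 0 < f t 0 then [f t 0] else []) @ filter ((<) 0) (snd (walk_of f t))"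
proof -
  obtain H where H': "\<forall>t. (\<forall>i\<ge>H. f t i = 0) \<and> (\<Sum>i<H. f t i) = b"
    using state_seqsD(1)[OF assms] by blast
  then have H: "\<And>t i. H \<le> i \<Longrightarrow> f t i = 0" and Hs: "\<And>t. (\<Sum>i<H. f t i) = b" by auto
  note le = state_seqsD(2)[OF assms]
  have p: "posn (f t) = filter (\<lambda>i. 0 < f t i) (0 # map Suc [0..<H])"
  proof -
    have "[0..<Suc H] = 0 # map Suc [0..<H]" by (simp add: upt_conv_Cons map_Suc_upt del: upt_Suc)
    then show ?thesis using posn_eq[of "Suc H" "f t"] H by simp
  qed
  have "filter (\<lambda>i. 0 < f t (Suc i)) (posn (f (Suc t))) = filter (\<lambda>i. 0 < f t (Suc i)) [0..<H]"
    using posn_eq[of H "f (Suc t)"] H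
    by (auto intro!: filter_cong intro: less_le_trans[OF _ le])
  then show ?thesis
    by (simp add: walk_of_def p filter_map o_def)
qed

lemma state_of_walk_of:
  assumes "f \<in> state_seqs b \<kappa>"
  shows "state_of (walk_of f) = f"
proof -
  obtain H where H': "\<forall>t. (\<forall>i\<ge>H. f t i = 0) \<and> (\<Sum>i<H. f t i) = b"
    using state_seqsD(1)[OF assms] by blast
  then have H: "\<And>t i. H \<le> i \<Longrightarrow> f t i = 0" and Hs: "\<And>t. (\<Sum>i<H. f t i) = b" by auto
  note le = state_seqsD(2)[OF assms]
  \<comment> \<open>The entry at \<open>Suc i\<close> and time \<open>t\<close> is decoded from the
    entries up to \<open>i\<close> at time \<open>Suc t\<close>, so the induction covers every
    \<open>t\<close> and every \<open>j \<le> i\<close> at once.\<close>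
  have "\<forall>t. \<forall>j\<le>i. state_of (walk_of f) t j = f t j" for i
  proof (induction i)
    case 0
    have "state_of (walk_of f) t 0 = f t 0" for t
      using walk_of_throw_iff[OF assms, of t] fst_walk_of[OF assms, of t] by (simp add: state_of_0)
    then show ?case by simp
  next
    case (Suc i)
    have "state_of (walk_of f) t (Suc i) = f t (Suc i)" for t
    proof (cases "0 < f (Suc t) i")
      case True
      have "filter (\<lambda>j. 0 < state_of (walk_of f) (Suc t) j) [0..<i] = filter (\<lambda>j. 0 < f (Suc t) j) [0..<i]"
        by (rule filter_cong) (use Suc in auto)
      then have "state_of (walk_of f) t (Suc i) =
          snd (walk_of f t) ! length (filter (\<lambda>j. 0 < f (Suc t) j) [0..<i])"
        using True Suc by (simp add: state_of_Suc)
      also have "\<dots> = f t (Suc i)"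
        using posn_nth[of H "f (Suc t)" i] True H by (simp add: walk_of_def)
      finally show ?thesis .
    next
      case False
      then show ?thesis using Suc le[of t i] by (simp add: state_of_Suc)
    qed
    then show ?case using Suc by (auto simp: le_Suc_eq)
  qed
  then show ?thesis by blast
qed

text \<open>A group can only grow until it lands, so its size is at most the number of balls thrown
  at its landing beat.\<close>

lemma state_le:
  assumes "f \<in> state_seqs b \<kappa>"
  shows "f t i \<le> \<kappa>"
proof -
  have "f t i \<le> f (t + i) 0"
  proof (induction i arbitrary: t)
    case (Suc i)
    have "f t (Suc i) \<le> f (Suc t) i" using assms by (auto simp: state_seqs_def)
    also have "\<dots> \<le> f (Suc t + i) 0" by (rule Suc)
    finally show ?case by simp
  qed simp
  also have "\<dots> \<le> \<kappa>" using assms by (simp add: state_seqs_def)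
  finally show ?thesis .
qed

lemma sorted_le_last: "x \<in> set xs \<Longrightarrow> sorted xs \<Longrightarrow> x \<le> last xs"
  by (cases xs rule: rev_cases) (auto simp: sorted_append)

lemma walk_of_in_full_walks:
  assumes f: "f \<in> state_seqs b \<kappa>" and per: "periodic n f"
  shows "walk_of f \<in> full_walks b \<kappa> n"
proof -
  obtain H where H': "\<forall>t. (\<forall>i\<ge>H. f t i = 0) \<and> (\<Sum>i<H. f t i) = b"
    using state_seqsD(1)[OF f] by blast
  then have H: "\<And>t i. H \<le> i \<Longrightarrow> f t i = 0" "\<And>t. (\<Sum>i<H. f t i) = b" by auto
  note le = state_seqsD(2)[OF f]
  have posn: "posn (f t) = filter (\<lambda>i. 0 < f t i) [0..<H]" for t
    using posn_eq[of H "f t"] H by simp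
  have "fst (walk_of f t) \<in> ord_partitions_bd b \<kappa>" for t
    using sum_list_posn[of H "f t"] H state_le[OF f]
    by (auto simp: ord_partitions_bd_def ord_partitions_def walk_of_def posn)
  moreover have "snd (walk_of f t) \<in> steps (fst (walk_of f t)) (fst (walk_of f (Suc t)))" for t
  proof (cases "f t 0 = 0")
    case True
    have eq: "snd (walk_of f t) = fst (walk_of f (Suc t))"
      using walk_of_throw_iff[OF f] True by simp
    have "filter ((<) 0) (fst (walk_of f (Suc t))) = fst (walk_of f (Suc t))"
      by (auto simp: walk_of_def posn intro!: filter_True)
    then have "fst (walk_of f t) = fst (walk_of f (Suc t))"
      using fst_walk_of[OF f, of t] True eq by simp
    then show ?thesis using eq by (simp add: steps_def list_all2_refl)
  next
    case False
    have "list_all2 (\<le>) (snd (walk_of f t)) (fst (walk_of f (Suc t)))"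
      by (simp add: walk_of_def list_all2_conv_all_nth le)
    then show ?thesis
      using False fst_walk_of[OF f, of t] by (simp add: steps_def)
  qed
  moreover have "periodic n (walk_of f)"
    using per by (simp add: periodic_def walk_of_def flip: add_Suc)
  moreover have "\<not> untouched (walk_of f)"
  proof
    assume un: "untouched (walk_of f)"
    then have ne: "posn (f t) \<noteq> []" for t by (auto simp: untouched_def walk_of_def)
    \<comment> \<open>The last group at \<open>Suc t\<close> received no throw, so its balls were in
      the air at time \<open>t\<close>, due one index later. The last landing time would descend
      forever.\<close>
    have "last (posn (f (Suc t))) < last (posn (f t))" for t
    proof -
      define m where "m = last (posn (f (Suc t)))"
      have "last (snd (walk_of f t)) = f t (Suc m)" "last (fst (walk_of f (Suc t))) = f (Suc t) m"
        using ne by (simp_all add: walk_of_def last_map m_def)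
      moreover have "0 < f (Suc t) m" using last_in_set[OF ne[of "Suc t"]] by (auto simp: posn m_def)
      ultimately have "0 < f t (Suc m)" using un by (auto simp: untouched_def)
      then have "Suc m \<in> set (posn (f t))" using set_posn[of H "f t"] H by simp
      then have "Suc m \<le> last (posn (f t))" by (rule sorted_le_last) (simp add: posn_def)
      then show ?thesis by (simp add: m_def)
    qed
    then show False
      using wf_no_infinite_down_chainE[OF wf_less_than, of "\<lambda>t. last (posn (f t))"] by auto
  qed
  ultimately show ?thesis by (simp add: full_walks_def closed_walks_def)
qed

section \<open>Decoding walks without an untouched last group\<close>

lemma filter_map_state_of_Suc:
  assumes "length (filter ((<) 0) (map (state_of y (Suc t)) [0..<k])) \<le> length (snd (y t))"
  shows "filter ((<) 0) (map (\<lambda>i. state_of y t (Suc i)) [0..<k]) =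
    filter ((<) 0) (take (length (filter ((<) 0) (map (state_of y (Suc t)) [0..<k]))) (snd (y t)))"
  using assms
proof (induction k)
  case (Suc k)
  define m where "m = length (filter ((<) 0) (map (state_of y (Suc t)) [0..<k]))"
  have m: "length (filter (\<lambda>j. 0 < state_of y (Suc t) j) [0..<k]) = m"
    by (simp add: m_def filter_map o_def)
  show ?case
  proof (cases "0 < state_of y (Suc t) k")
    case True
    then have len: "length (filter ((<) 0) (map (state_of y (Suc t)) [0..<Suc k])) = Suc m"
      by (simp add: m_def)
    then have "m < length (snd (y t))" using Suc.prems by simp
    \<comment> \<open>\<open>m\<close> is the rank of position \<open>k\<close> at time
      \<open>Suc t\<close>, so \<open>state_of_Suc\<close> reads entry \<open>m\<close> of the card:
      successive groups consume successive card entries. The length bound keeps this index in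
      range.\<close>
    then have "take (Suc m) (snd (y t)) = take m (snd (y t)) @ [state_of y t (Suc k)]"
      using True m by (simp add: take_Suc_conv_app_nth state_of_Suc)
    moreover have "filter ((<) 0) (map (\<lambda>i. state_of y t (Suc i)) [0..<k]) =
        filter ((<) 0) (take m (snd (y t)))"
      using Suc.IH \<open>m < length (snd (y t))\<close> by (simp add: m_def)
    ultimately show ?thesis unfolding len by simp
  next
    case False
    then have "state_of y t (Suc k) = 0" by (simp add: state_of_Suc)
    then show ?thesis using Suc False by simp
  qed
qed simp

lemma finite_of_bounded_count:
  assumes "\<And>k. length (filter P [0..<k]) \<le> b"
  shows "finite {i::nat. P i}"
proof (rule ccontr)
  assume "infinite {i. P i}"
  then obtain B where B: "B \<subseteq> {i. P i}" "finite B" "card B = Suc b"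
    by (metis infinite_arbitrarily_large)
  obtain k where "\<forall>i\<in>B. i < k" using B(2) finite_nat_set_iff_bounded by auto
  then have "B \<subseteq> set (filter P [0..<k])" using B(1) by auto
  then have "card B \<le> card (set (filter P [0..<k]))" by (intro card_mono) auto
  also have "\<dots> \<le> length (filter P [0..<k])" by (rule card_length)
  also have "\<dots> \<le> b" by (rule assms)
  finally show False using B(3) by simp
qed

lemma list_all2_le_sum_eq:
  assumes "list_all2 (\<le>) x (z::nat list)" "sum_list z \<le> sum_list x"
  shows "x = z"
  using assms
proof (induction rule: list_all2_induct)
  case (Cons a xs c zs)
  have "sum_list xs \<le> sum_list zs" using Cons(2) by (induction rule: list_all2_induct) auto
  then show ?case using Cons by auto
qed simp

lemma sum_list_filter_pos: "sum_list (filter ((<) 0) x) = sum_list (x::nat list)"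
  by (induction x) auto

lemma list_all2_le_sum: "list_all2 (\<le>) x (z::nat list) \<Longrightarrow> sum_list x \<le> sum_list z"
  by (induction rule: list_all2_induct) auto

text \<open>Counterpart of \<open>fst_walk_of\<close> for arbitrary card walks. If the card equals
  the next partition, it is trivial: for a throw card the entries would sum to that of
  \<open>tl (fst (y t))\<close>, which is less than \<open>b\<close>.\<close>

lemma fst_card_walk:
  assumes "y \<in> card_walks b \<kappa> n"
  shows "fst (y t) = (if snd (y t) = fst (y (Suc t)) then [] else [hd (fst (y t))])
           @ filter ((<) 0) (snd (y t))"
proof -
  have st: "snd (y t) \<in> steps (fst (y t)) (fst (y (Suc t)))"
    and pt: "\<And>t. fst (y t) \<in> ord_partitions_bd b \<kappa>"
    using assms by (auto simp: closed_walks_def)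
  have pos: "filter ((<) 0) (fst (y t)) = fst (y t)" for t
    using pt[of t] by (auto simp: ord_partitions_bd_def ord_partitions_def intro: filter_True)
  show ?thesis
  proof (cases "snd (y t) = fst (y (Suc t))")
    case True
    have "sum_list (tl (fst (y t))) \<noteq> b" if "fst (y t) \<noteq> []"
      using pt[of t] that by (cases "fst (y t)") (auto simp: ord_partitions_bd_def ord_partitions_def)
    moreover have "sum_list (fst (y (Suc t))) = b"
      using pt by (auto simp: ord_partitions_bd_def ord_partitions_def)
    ultimately have "fst (y t) = fst (y (Suc t))"
      using st True pos[of "Suc t"] by (auto simp: steps_def)
    then show ?thesis using True pos[of "Suc t"] by simp
  next
    case False
    then show ?thesis using st by (auto simp: steps_def)
  qed
qed

text \<open>The groups decoded up to position \<open>k\<close> are followed by those not yet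
  reached. Whether decoding reaches every group is left open here and settled for full walks in
  \<open>full_walk_decoded\<close>.\<close>

lemma state_of_prefix:
  assumes "y \<in> card_walks b \<kappa> n"
  shows "fst (y t) = filter ((<) 0) (map (state_of y t) [0..<Suc k]) @
    filter ((<) 0) (drop (length (filter ((<) 0) (map (state_of y (Suc t)) [0..<k]))) (snd (y t)))"
proof (induction k arbitrary: t rule: less_induct)
  case (less k)
  define m where "m = length (filter ((<) 0) (map (state_of y (Suc t)) [0..<k]))"
  have len: "length (snd (y t)) = length (fst (y (Suc t)))"
    using assms by (auto simp: closed_walks_def steps_def dest!: list_all2_lengthD)
  \<comment> \<open>For positive \<open>k\<close> this comes from the claim for \<open>k - 1\<close>
    at time \<open>Suc t\<close>: the decoded groups there form a prefix of a partition as long as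
    the card.\<close>
  have "m \<le> length (snd (y t))"
  proof (cases k)
    case (Suc k')
    then show ?thesis
      unfolding len m_def using less[of k' "Suc t"] by (metis length_append le_add1 lessI)
  qed (simp add: m_def)
  then have *: "filter ((<) 0) (map (\<lambda>i. state_of y t (Suc i)) [0..<k]) =
      filter ((<) 0) (take m (snd (y t)))"
    unfolding m_def by (rule filter_map_state_of_Suc)
  have pos: "0 < a" if "a \<in> set (fst (y t))" for a
    using assms that by (auto simp: closed_walks_def ord_partitions_bd_def ord_partitions_def)
  have "map (state_of y t) [0..<Suc k] = state_of y t 0 # map (\<lambda>i. state_of y t (Suc i)) [0..<k]"
    by (simp add: upt_conv_Cons map_Suc_upt[symmetric] o_def del: upt_Suc)
  then have N: "filter ((<) 0) (map (state_of y t) [0..<Suc k]) =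
      (if 0 < state_of y t 0 then [state_of y t 0] else []) @ filter ((<) 0) (take m (snd (y t)))"
    using * by simp
  have "0 < hd (fst (y t))" if "snd (y t) \<noteq> fst (y (Suc t))"
  proof (rule pos, rule hd_in_set)
    show "fst (y t) \<noteq> []" using fst_card_walk[OF assms, of t] that by auto
  qed
  then have "(if 0 < state_of y t 0 then [state_of y t 0] else []) =
      (if snd (y t) = fst (y (Suc t)) then [] else [hd (fst (y t))])"
    by (simp add: state_of_0)
  moreover have "filter ((<) 0) (snd (y t)) =
      filter ((<) 0) (take m (snd (y t))) @ filter ((<) 0) (drop m (snd (y t)))"
    by (metis append_take_drop_id filter_append)
  ultimately have "fst (y t) = filter ((<) 0) (map (state_of y t) [0..<Suc k])
      @ filter ((<) 0) (drop m (snd (y t)))"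
    using fst_card_walk[OF assms, of t] N by simp
  then show ?case by (simp only: m_def)
qed

lemma periodic_state_of:
  assumes "periodic n y"
  shows "periodic n (state_of y)"
proof -
  have "decode y i (t + n) = decode y i t" for i t
    by (induction i arbitrary: t) (use assms in \<open>simp_all add: periodic_def flip: add_Suc\<close>)
  then show ?thesis by (simp add: periodic_def state_of_def fun_eq_iff)
qed

lemma periodic_imp_const:
  fixes g :: "nat \<Rightarrow> nat"
  assumes "periodic n g" "0 < n" "\<And>t. g t \<le> g (Suc t)"
  shows "g (Suc t) = g t"
proof -
  have "mono g" using assms(3) by (simp add: mono_iff_le_Suc)
  then have "g (Suc t) \<le> g (t + n)" using assms(2) by (intro monoD[of g]) auto
  then show ?thesis using assms(1) assms(3)[of t] by (auto simp: periodic_def intro: antisym)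
qed

text \<open>Decoding yields a prefix of each partition; a nonempty remainder would be preserved by
  every card and make the walk untouched.\<close>

lemma full_walk_decoded:
  assumes y: "y \<in> full_walks b \<kappa> n" and n: "0 < n"
  shows "\<exists>H. \<forall>t. (\<forall>i\<ge>H. state_of y t i = 0) \<and>
    fst (y t) = filter ((<) 0) (map (state_of y t) [0..<H])"
proof -
  define f where "f = state_of y"
  define N where "N t k = filter ((<) 0) (map (f t) [0..<k])" for t k
  have cw: "y \<in> card_walks b \<kappa> n" and un: "\<not> untouched y" using y by (auto simp: full_walks_def)
  have pery: "periodic n y" using cw by (simp add: closed_walks_def)
  have pt: "fst (y t) \<in> ord_partitions_bd b \<kappa>" for t using cw by (auto simp: closed_walks_def)
  have pos: "0 < a" if "a \<in> set (fst (y t))" for a t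
    using pt that by (auto simp: ord_partitions_bd_def ord_partitions_def)
  have len_b: "length (fst (y t)) \<le> b" for t
    using length_le_sum_list[of "fst (y t)"] pt[of t] by (auto simp: ord_partitions_bd_def ord_partitions_def)
  have pref_Suc: "fst (y t) = N t (Suc k) @ filter ((<) 0) (drop (length (N (Suc t) k)) (snd (y t)))" for t k
    using state_of_prefix[OF cw] by (simp only: N_def f_def)
  have pref: "\<exists>z. fst (y t) = N t k @ z" for t k
    using pref_Suc[of t "k - 1"] by (cases k) (auto simp: N_def)
  have perf: "periodic n f" using periodic_state_of[OF pery] by (simp add: f_def)
  \<comment> \<open>Each positive entry accounts for one of at most \<open>b\<close> parts.
    Periodicity leaves only \<open>n\<close> supports to consider, so a common bound
    \<open>H\<close> exists.\<close>
  have "finite {i. 0 < f t i}" for t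
  proof (rule finite_of_bounded_count)
    fix k
    have "length (filter (\<lambda>i. 0 < f t i) [0..<k]) = length (N t k)" by (simp add: N_def filter_map o_def)
    also have "\<dots> \<le> length (fst (y t))" using pref[of t k] by (metis length_append le_add1)
    finally show "length (filter (\<lambda>i. 0 < f t i) [0..<k]) \<le> b" using len_b[of t] by simp
  qed
  then have "finite (\<Union>t<n. {i. 0 < f t i})" by simp
  then have "\<exists>H. \<forall>i\<in>(\<Union>t<n. {i. 0 < f t i}). i < H"
    by (simp only: finite_nat_set_iff_bounded)
  then obtain H where H: "\<forall>i\<in>(\<Union>t<n. {i. 0 < f t i}). i < H" ..
  have sup: "f t i = 0" if "H \<le> i" for t i
  proof -
    have "\<not> 0 < f (t mod n) i"
    proof
      assume "0 < f (t mod n) i"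
      then have "i \<in> (\<Union>t<n. {i. 0 < f t i})" using n by (auto intro!: bexI[of _ "t mod n"])
      then have "i < H" by (rule H[rule_format])
      then show False using that by simp
    qed
    then show ?thesis using periodic_mod[OF perf, of t] by simp
  qed
  \<comment> \<open>\<open>z t\<close> is the tail of the partition that decoding never reaches, and
    \<open>x' t\<close> the part of the card lying over the tail at \<open>Suc t\<close>.\<close>
  define z where "z t = drop (length (N t H)) (fst (y t))" for t
  have z: "fst (y t) = N t H @ z t" for t using pref[of t H] by (auto simp: z_def)
  define x' where "x' t = drop (length (N (Suc t) H)) (snd (y t))" for t
  have le: "list_all2 (\<le>) (x' t) (z (Suc t))" for t
    using cw unfolding x'_def z_def by (auto simp: closed_walks_def steps_def intro: list_all2_dropI)
  have zx: "z t = filter ((<) 0) (x' t)" for t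
  proof -
    have "N t (Suc H) = N t H" using sup by (simp add: N_def)
    then show ?thesis using pref_Suc[of t H] z[of t] by (simp add: x'_def)
  qed
  \<comment> \<open>A periodic monotone sum is constant, so \<open>x' t\<close> and
    \<open>z (Suc t)\<close>, comparable entrywise and of equal sum, coincide.\<close>
  have "sum_list (z t) \<le> sum_list (z (Suc t))" for t
    using list_all2_le_sum[OF le[of t]] by (simp add: zx[of t] sum_list_filter_pos)
  moreover have "periodic n (\<lambda>t. sum_list (z t))"
    using pery perf by (simp add: periodic_def z_def N_def)
  ultimately have const: "sum_list (z (Suc t)) = sum_list (z t)" for t
    using periodic_imp_const[of n "\<lambda>t. sum_list (z t)" t] n by simp
  then have const0: "sum_list (z t) = sum_list (z 0)" for t by (induction t) auto
  have "x' t = z (Suc t)" for t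
    by (rule list_all2_le_sum_eq[OF le]) (use const[of t] zx[of t] in \<open>simp add: sum_list_filter_pos\<close>)
  moreover have zpos: "z t \<noteq> [] \<longleftrightarrow> 0 < sum_list (z t)" for t
    using pos[of _ t] z[of t] by (cases "z t") auto
  \<comment> \<open>By constancy of the sum, a tail that is nonempty once is nonempty at all times,
    and its last group never receives a throw.\<close>
  ultimately have "untouched y" if "z t0 \<noteq> []" for t0
  proof -
    have ne: "z t \<noteq> []" for t using that zpos const0 by metis
    have "last (snd (y t)) = last (fst (y (Suc t)))" for t
    proof -
      have "last (snd (y t)) = last (x' t)" using ne[of "Suc t"] \<open>\<And>t. x' t = z (Suc t)\<close>[of t]
        unfolding x'_def by (metis append_take_drop_id last_appendR)
      also have "\<dots> = last (fst (y (Suc t)))" using ne[of "Suc t"] z[of "Suc t"] \<open>\<And>t. x' t = z (Suc t)\<close>[of t] by simp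
      finally show ?thesis .
    qed
    moreover have "fst (y t) \<noteq> []" for t using ne[of t] z[of t] by simp
    ultimately show ?thesis by (simp add: untouched_def)
  qed
  then have "z t = []" for t using un by blast
  then show ?thesis using z sup by (intro exI[of _ H]) (simp add: N_def f_def)
qed

lemma full_walk_state_of:
  assumes y: "y \<in> full_walks b \<kappa> n" and n: "0 < n"
  shows "state_of y \<in> state_seqs b \<kappa>" "periodic n (state_of y)" "walk_of (state_of y) = y"
proof -
  define f where "f = state_of y"
  have cw: "y \<in> card_walks b \<kappa> n" using y by (auto simp: full_walks_def)
  have pt: "fst (y t) \<in> ord_partitions_bd b \<kappa>" for t using cw by (auto simp: closed_walks_def)
  have le: "list_all2 (\<le>) (snd (y t)) (fst (y (Suc t)))" for t
    using cw by (auto simp: closed_walks_def steps_def)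
  obtain H where H: "\<forall>t. (\<forall>i\<ge>H. f t i = 0) \<and> fst (y t) = filter ((<) 0) (map (f t) [0..<H])"
    using full_walk_decoded[OF assms] by (auto simp: f_def)
  then have sup: "\<forall>i\<ge>H. f t i = 0" for t by blast
  have posn: "posn (f t) = filter (\<lambda>i. 0 < f t i) [0..<H]" for t
    using sup by (simp add: posn_eq)
  have fst_y: "fst (y t) = map (f t) (posn (f t))" for t
    using H by (simp add: posn filter_map o_def)
  \<comment> \<open>\<open>c\<close> is the rank of \<open>i\<close> among the occupied landing
    times, so the same index addresses a group and its card entry.\<close>
  have f_Suc: "f t (Suc i) = snd (y t) ! c \<and> c < length (fst (y (Suc t))) \<and> fst (y (Suc t)) ! c = f (Suc t) i"
    if "0 < f (Suc t) i" "c = length (filter (\<lambda>j. 0 < f (Suc t) j) [0..<i])" for t i c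
    using that posn_nth[OF sup that(1)] state_of_Suc[of y t i] by (simp add: fst_y flip: f_def)
  have "f t (Suc i) \<le> f (Suc t) i" for t i
  proof (cases "0 < f (Suc t) i")
    case True
    show ?thesis using f_Suc[OF True refl] list_all2_nthD2[OF le[of t]] by metis
  qed (simp add: f_def state_of_Suc)
  moreover have "f t 0 \<le> \<kappa>" for t
    using fst_card_walk[OF cw, of t] pt[of t]
    by (auto simp: f_def state_of_0 ord_partitions_bd_def) (metis list.set_intros(1))
  moreover have "(\<Sum>i<H. f t i) = b" for t
    using sum_list_posn[OF sup, of t] pt[of t] by (simp add: fst_y ord_partitions_bd_def ord_partitions_def)
  ultimately show "state_of y \<in> state_seqs b \<kappa>"
    using sup unfolding state_seqs_def f_def by blast
  show "periodic n (state_of y)" using cw periodic_state_of by (simp add: closed_walks_def)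
  have "map (\<lambda>i. f t (Suc i)) (posn (f (Suc t))) = snd (y t)" for t
  proof (rule nth_equalityI)
    show len: "length (map (\<lambda>i. f t (Suc i)) (posn (f (Suc t)))) = length (snd (y t))"
      using list_all2_lengthD[OF le[of t]] by (simp add: fst_y)
    fix p assume p: "p < length (map (\<lambda>i. f t (Suc i)) (posn (f (Suc t))))"
    define i where "i = posn (f (Suc t)) ! p"
    have i: "0 < f (Suc t) i" using p nth_mem[of p "posn (f (Suc t))"] by (simp add: i_def posn)
    define c where "c = length (filter (\<lambda>j. 0 < f (Suc t) j) [0..<i])"
    have "c < length (posn (f (Suc t)))" "posn (f (Suc t)) ! c = i"
      using posn_nth[OF sup i] by (simp_all add: c_def)
    moreover have "distinct (posn (f (Suc t)))" by (simp add: posn)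
    ultimately have "c = p" using p by (simp add: i_def nth_eq_iff_index_eq)
    then show "map (\<lambda>i. f t (Suc i)) (posn (f (Suc t))) ! p = snd (y t) ! p"
      using f_Suc[OF i c_def] p by (simp add: i_def)
  qed
  then show "walk_of (state_of y) = y" using fst_y by (simp add: walk_of_def f_def fun_eq_iff prod_eq_iff)
qed

lemma bij_betw_walk_of:
  assumes "0 < n"
  shows "bij_betw walk_of {f \<in> state_seqs b \<kappa>. periodic n f} (full_walks b \<kappa> n)"
  by (rule bij_betwI[where g = state_of])
    (use assms in \<open>auto simp: walk_of_in_full_walks full_walk_state_of state_of_walk_of\<close>)

section \<open>Siteswaps\<close>

text \<open>Balls due at index \<open>h - 1\<close> afterwards but not due at \<open>h\<close>
  before were thrown to height \<open>h\<close>. Height 0 is treated apart because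
  \<open>h - 1\<close> would truncate; finiteness of the support is shown in
  \<open>count_throws\<close>.\<close>

definition throws :: "(nat \<Rightarrow> nat) \<Rightarrow> (nat \<Rightarrow> nat) \<Rightarrow> nat multiset" where
  "throws g g' = Abs_multiset (\<lambda>h. if h = 0 then 0 else g' (h - 1) - g h)"

lemma count_throws:
  assumes "\<forall>i\<ge>H. g' i = 0"
  shows "count (throws g g') h = (if h = 0 then 0 else g' (h - 1) - g h)"
proof -
  have "{h. 0 < (if h = 0 then 0 else g' (h - 1) - g h)} \<subseteq> {..H}"
  proof
    fix h assume "h \<in> {h. 0 < (if h = 0 then 0 else g' (h - 1) - g h)}"
    then have "h \<noteq> 0" "g' (h - 1) \<noteq> 0" by (auto split: if_splits)
    then show "h \<in> {..H}" using assms by (cases h) (auto simp: not_less_eq_eq[symmetric])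
  qed
  then have "finite {h. 0 < (if h = 0 then 0 else g' (h - 1) - g h)}" by (rule finite_subset) simp
  then show ?thesis unfolding throws_def by (subst count_Abs_multiset) simp_all
qed

lemma sum_mset_eq_sum_count:
  fixes g :: "nat \<Rightarrow> nat"
  assumes "set_mset M \<subseteq> {1..H}"
  shows "(\<Sum>h\<in>#M. g h) = (\<Sum>i<H. count M (Suc i) * g (Suc i))"
  using assms
proof (induction M)
  case (add x M)
  then obtain j where j: "x = Suc j" "j < H" by (cases x) auto
  have "(\<Sum>i<H. count (add_mset x M) (Suc i) * g (Suc i)) =
      (\<Sum>i<H. count M (Suc i) * g (Suc i) + (if i = j then g (Suc i) else 0))"
    by (intro sum.cong) (auto simp: j)
  then show ?case using add j by (simp add: sum.distrib)
qed simp

lemma size_eq_sum_count: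
  assumes "set_mset M \<subseteq> {1..H}"
  shows "size M = (\<Sum>i<H. count M (Suc i))"
  using sum_mset_eq_sum_count[OF assms, of "\<lambda>_. 1"] by (simp only: size_eq_sum_mset mult_1_right)

lemma size_filter_eq_sum_count:
  assumes "set_mset M \<subseteq> {1..H}"
  shows "size (filter_mset P M) = (\<Sum>i<H. if P (Suc i) then count M (Suc i) else 0)"
proof -
  have "set_mset (filter_mset P M) \<subseteq> {1..H}" using assms by auto
  then show ?thesis by (simp add: size_eq_sum_count)
qed

text \<open>Exactly one beat of a period is congruent to \<open>t - h\<close>; adding the multiple
  \<open>N\<close> of \<open>n\<close> expresses it without truncation.\<close>

lemma sum_residue_class:
  fixes F :: "nat \<Rightarrow> nat"
  assumes "periodic n F" "t < n" "n dvd N" "h \<le> N"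
  shows "(\<Sum>s<n. if (s + h) mod n = t then F s else 0) = F (t + N - h)"
proof -
  have "(s + h) mod n = t \<longleftrightarrow> s = (t + N - h) mod n" if "s < n" for s
  proof
    assume "(s + h) mod n = t"
    then have "(t + N - h) mod n = ((s + h) mod n + (N - h)) mod n" using assms(4) by simp
    also have "\<dots> = (s + h + (N - h)) mod n" by (rule mod_add_left_eq)
    also have "\<dots> = (s + N) mod n" using assms(4) by simp
    also have "\<dots> = s" using assms(3) that by auto
    finally show "s = (t + N - h) mod n" by simp
  next
    assume "s = (t + N - h) mod n"
    then have "(s + h) mod n = (t + N - h + h) mod n" by (simp only: mod_add_left_eq)
    then show "(s + h) mod n = t" using assms(2,3,4) by auto
  qed
  then have "(\<Sum>s<n. if (s + h) mod n = t then F s else 0) =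
      (\<Sum>s<n. if s = (t + N - h) mod n then F s else 0)"
    by (intro sum.cong) auto
  also have "\<dots> = F ((t + N - h) mod n)" using assms(2) by simp
  finally show ?thesis using periodic_mod[OF assms(1)] by simp
qed

text \<open>Sorted by height, the balls landing at beat \<open>t\<close> come from one beat for each
  height \<open>Suc i\<close>, namely \<open>t - Suc i\<close> modulo \<open>n\<close>.\<close>

lemma sum_landings:
  assumes "\<And>s. s < n \<Longrightarrow> set_mset (M s) \<subseteq> {1..H}" "t < n" "n dvd N" "H \<le> N"
  shows "(\<Sum>s<n. size (filter_mset (\<lambda>h. (s + h) mod n = t) (M s))) =
    (\<Sum>i<H. count (M ((t + N - Suc i) mod n)) (Suc i))"
proof -
  have "(\<Sum>s<n. size (filter_mset (\<lambda>h. (s + h) mod n = t) (M s))) =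
      (\<Sum>s<n. \<Sum>i<H. if (s + Suc i) mod n = t then count (M s) (Suc i) else 0)"
    by (intro sum.cong refl size_filter_eq_sum_count) (use assms(1) in auto)
  also have "\<dots> = (\<Sum>i<H. \<Sum>s<n. if (s + Suc i) mod n = t then count (M (s mod n)) (Suc i) else 0)"
    by (subst sum.swap) (intro sum.cong refl, auto)
  also have "\<dots> = (\<Sum>i<H. count (M ((t + N - Suc i) mod n)) (Suc i))"
    by (intro sum.cong refl sum_residue_class) (use assms in \<open>auto simp: periodic_def\<close>)
  finally show ?thesis .
qed

lemma sum_telescope_antimono:
  fixes a :: "nat \<Rightarrow> nat"
  assumes "\<And>i. i < k \<Longrightarrow> a (Suc i) \<le> a i"
  shows "(\<Sum>i<k. a i - a (Suc i)) + a k = a 0"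
  using assms
proof (induction k)
  case (Suc k)
  then have "(\<Sum>i<k. a i - a (Suc i)) + a k = a 0" "a (Suc k) \<le> a k" by simp_all
  then show ?case by simp
qed simp

lemma sum_periodic_shift:
  fixes g :: "nat \<Rightarrow> nat"
  assumes "periodic n g"
  shows "(\<Sum>t<n. g (Suc t)) = (\<Sum>t<n. g t)"
proof -
  have "g n = g 0" using assms unfolding periodic_def by (metis add_0)
  then have "(\<Sum>t<n. g (Suc t)) + g 0 = (\<Sum>t<n. g t) + g 0"
    using sum.lessThan_Suc_shift[of g n] by simp
  then show ?thesis by simp
qed

text \<open>The potential \<open>W\<close> is the total remaining flight time. From one beat to the
  next it gains the heights thrown and loses one unit per ball; over a period \<open>W\<close>
  cancels.\<close>

lemma sum_throw_heights:
  fixes f :: "nat \<Rightarrow> nat \<Rightarrow> nat"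
  assumes "periodic n f" "\<And>t i. H \<le> i \<Longrightarrow> f t i = 0" "\<And>t i. f t (Suc i) \<le> f (Suc t) i"
  shows "(\<Sum>t<n. \<Sum>i<H. (f (Suc t) i - f t (Suc i)) * Suc i) = (\<Sum>t<n. \<Sum>i<H. f t i)"
proof -
  define W where "W t = (\<Sum>i<H. f t i * i)" for t
  define B where "B t = (\<Sum>i<H. f t i)" for t
  have step: "(\<Sum>i<H. (f (Suc t) i - f t (Suc i)) * Suc i) + W t = W (Suc t) + B (Suc t)" for t
  proof -
    have "W t = (\<Sum>i<Suc H. f t i * i)" using assms(2) by (simp add: W_def)
    also have "\<dots> = (\<Sum>i<H. f t (Suc i) * Suc i)" by (simp only: sum.lessThan_Suc_shift mult_0_right add_0)
    finally have "(\<Sum>i<H. (f (Suc t) i - f t (Suc i)) * Suc i) + W t =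
        (\<Sum>i<H. (f (Suc t) i - f t (Suc i)) * Suc i + f t (Suc i) * Suc i)"
      by (simp only: sum.distrib)
    also have "\<dots> = (\<Sum>i<H. f (Suc t) i * Suc i)"
      by (intro sum.cong refl) (use assms(3) in \<open>simp only: add_mult_distrib[symmetric] le_add_diff_inverse2\<close>)
    finally show ?thesis by (simp add: W_def B_def sum.distrib)
  qed
  have "periodic n W" "periodic n B" using assms(1) by (simp_all add: periodic_def W_def B_def)
  then have "(\<Sum>t<n. W (Suc t)) = (\<Sum>t<n. W t)" "(\<Sum>t<n. B (Suc t)) = (\<Sum>t<n. B t)"
    by (simp_all add: sum_periodic_shift)
  moreover have "(\<Sum>t<n. (\<Sum>i<H. (f (Suc t) i - f t (Suc i)) * Suc i) + W t) = (\<Sum>t<n. W (Suc t) + B (Suc t))"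
    by (simp only: step)
  ultimately show ?thesis by (simp add: sum.distrib B_def)
qed

definition siteswap_of :: "nat \<Rightarrow> (nat \<Rightarrow> nat \<Rightarrow> nat) \<Rightarrow> nat \<Rightarrow> nat multiset" where
  "siteswap_of n f t = (if t < n then throws (f t) (f (Suc t)) else {#})"

text \<open>Conservation of balls gives \<open>f t 0\<close> throws at beat \<open>t\<close>,
  telescoping gives as many landings, and \<open>sum_throw_heights\<close> gives the number of
  balls.\<close>

lemma siteswap_of_mem:
  assumes f: "f \<in> state_seqs b \<kappa>" and per: "periodic n f"
  shows "siteswap_of n f \<in> siteswaps b \<kappa> n"
proof -
  obtain H where H': "\<forall>t. (\<forall>i\<ge>H. f t i = 0) \<and> (\<Sum>i<H. f t i) = b"
    using state_seqsD(1)[OF f] by blast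
  then have sup: "\<And>t. \<forall>i\<ge>H. f t i = 0" and Hs: "\<And>t. (\<Sum>i<H. f t i) = b" by auto
  note le = state_seqsD(2)[OF f]
  define M where "M t = throws (f t) (f (Suc t))" for t
  have cnt: "count (M t) (Suc i) = f (Suc t) i - f t (Suc i)" for t i
    using count_throws[OF sup, of "f t" "Suc t" "Suc i"] by (simp add: M_def)
  have cnt0: "count (M t) 0 = 0" for t
    using count_throws[OF sup, of "f t" "Suc t" 0] by (simp add: M_def)
  have set: "set_mset (M t) \<subseteq> {1..H}" for t
  proof
    fix h assume "h \<in># M t"
    then have "0 < count (M t) h" by simp
    then have h: "h \<noteq> 0" "f (Suc t) (h - 1) \<noteq> 0"
      using cnt[of t "h - 1"] cnt0[of t] by (cases h; simp)+
    then have "h - 1 < H" using sup[of "Suc t"] by (metis leI)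
    then show "h \<in> {1..H}" using h(1) by auto
  qed
  have perM: "M (t mod n) = M t" for t
    by (rule periodic_mod) (use per in \<open>simp add: periodic_def M_def flip: add_Suc\<close>)
  have size: "size (M t) = f t 0" for t
  proof -
    have "size (M t) = (\<Sum>i<H. f (Suc t) i - f t (Suc i))"
      by (simp add: size_eq_sum_count[OF set] cnt)
    also have "\<dots> = (\<Sum>i<H. f (Suc t) i) - (\<Sum>i<H. f t (Suc i))"
      by (rule sum_subtractf_nat) (rule le)
    also have "(\<Sum>i<H. f (Suc t) i) = (\<Sum>i<Suc H. f t i)" using Hs sup by simp
    also have "\<dots> = f t 0 + (\<Sum>i<H. f t (Suc i))" by (simp only: sum.lessThan_Suc_shift)
    finally show ?thesis by simp
  qed
  have land: "(\<Sum>s<n. size (filter_mset (\<lambda>h. (s + h) mod n = t) (siteswap_of n f s))) = f t 0"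
    if t: "t < n" for t
  proof -
    \<comment> \<open>A multiple of \<open>n\<close> that is at least \<open>H\<close>, so that
      going back \<open>H\<close> beats from \<open>t + N\<close> stays within the natural
      numbers.\<close>
    define N where "N = n * H"
    have HN: "H \<le> N" using t by (cases n) (auto simp: N_def)
    have "(\<Sum>s<n. size (filter_mset (\<lambda>h. (s + h) mod n = t) (siteswap_of n f s))) =
        (\<Sum>s<n. size (filter_mset (\<lambda>h. (s + h) mod n = t) (M s)))"
      by (intro sum.cong) (auto simp: siteswap_of_def M_def)
    also have "\<dots> = (\<Sum>i<H. count (M (t + N - Suc i)) (Suc i))"
      using sum_landings[of n M H t N] set t HN by (simp add: perM N_def)
    also have "\<dots> = (\<Sum>i<H. f (t + N - i) i - f (t + N - Suc i) (Suc i))"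
    proof (intro sum.cong refl)
      fix i assume "i \<in> {..<H}"
      then have "Suc (t + N - Suc i) = t + N - i" using HN by (simp add: Suc_diff_Suc)
      then show "count (M (t + N - Suc i)) (Suc i) = f (t + N - i) i - f (t + N - Suc i) (Suc i)"
        by (simp only: cnt)
    qed
    \<comment> \<open>All entries \<open>f (t + N - i) i\<close> count balls due at beat
      \<open>t + N\<close>. The sum telescopes along this diagonal, and its end at
      \<open>i = H\<close> is 0.\<close>
    also have "\<dots> = f (t + N) 0"
    proof -
      have "f (t + N - Suc i) (Suc i) \<le> f (t + N - i) i" if "i < H" for i
      proof -
        have "Suc (t + N - Suc i) = t + N - i" using HN that by (simp add: Suc_diff_Suc)
        then show ?thesis using le[of "t + N - Suc i" i] by simp
      qed
      then show ?thesis
        using sum_telescope_antimono[of H "\<lambda>i. f (t + N - i) i"] sup by simp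
    qed
    also have "\<dots> = f t 0" using periodic_mod[OF per, of "t + N"] periodic_mod[OF per, of t] by (simp add: N_def)
    finally show ?thesis .
  qed
  have "is_mss n (siteswap_of n f)"
    unfolding is_mss_def
  proof (intro conjI allI impI ballI)
    fix t h assume "t < n" "h \<in># siteswap_of n f t"
    then show "0 < h" using set[of t] by (auto simp: siteswap_of_def M_def)
  qed (use size land in \<open>simp_all add: siteswap_of_def M_def\<close>)
  moreover have "mss_balls n (siteswap_of n f) b"
  proof -
    have "(\<Sum>t<n. sum_mset (siteswap_of n f t)) = (\<Sum>t<n. sum_mset (M t))"
      by (intro sum.cong) (auto simp: siteswap_of_def M_def)
    also have "\<dots> = (\<Sum>t<n. \<Sum>i<H. (f (Suc t) i - f t (Suc i)) * Suc i)"
      using sum_mset_eq_sum_count[OF set, of "\<lambda>h. h"] by (simp add: cnt)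
    also have "\<dots> = (\<Sum>t<n. \<Sum>i<H. f t i)"
      by (rule sum_throw_heights[OF per]) (use sup le in auto)
    finally show ?thesis using Hs by (simp add: mss_balls_def)
  qed
  moreover have "size (siteswap_of n f t) \<le> \<kappa>" if "t < n" for t
    using size[of t] state_seqsD(3)[OF f] that by (simp add: siteswap_of_def M_def)
  ultimately show ?thesis by (simp add: siteswaps_def)
qed

text \<open>Equal throws make the difference \<open>d\<close> of the two sequences satisfy
  \<open>d (Suc t) i = d t (Suc i)\<close>. Going around enough periods moves any entry of
  \<open>d\<close> beyond both supports without changing it, so \<open>d\<close> vanishes.\<close>

lemma siteswap_of_inj:
  assumes n: "0 < n" and f: "f \<in> state_seqs b \<kappa>" "periodic n f" and g: "g \<in> state_seqs b \<kappa>" "periodic n g"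
    and eq: "siteswap_of n f = siteswap_of n g"
  shows "f = g"
proof -
  obtain H where H: "\<forall>t. (\<forall>i\<ge>H. f t i = 0) \<and> (\<Sum>i<H. f t i) = b"
    using state_seqsD(1)[OF f(1)] by blast
  obtain K where K: "\<forall>t. (\<forall>i\<ge>K. g t i = 0) \<and> (\<Sum>i<K. g t i) = b"
    using state_seqsD(1)[OF g(1)] by blast
  have supf: "\<forall>i\<ge>H. f t i = 0" and supg: "\<forall>i\<ge>K. g t i = 0" for t using H K by auto
  define d where "d t i = int (f t i) - int (g t i)" for t i
  have "d (Suc t) i = d t (Suc i)" if t: "t < n" for t i
  proof -
    have "throws (f t) (f (Suc t)) = throws (g t) (g (Suc t))"
      using fun_cong[OF eq, of t] t by (simp add: siteswap_of_def)
    then have "f (Suc t) i - f t (Suc i) = g (Suc t) i - g t (Suc i)"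
      using count_throws[OF supf, of "f t" "Suc t" "Suc i"] count_throws[OF supg, of "g t" "Suc t" "Suc i"] by simp
    then show ?thesis
      using state_seqsD(2)[OF f(1), of t i] state_seqsD(2)[OF g(1), of t i] by (simp add: d_def)
  qed
  moreover have perd: "periodic n d" using f(2) g(2) by (simp add: periodic_def d_def fun_eq_iff)
  moreover have "d (Suc (t mod n)) = d (Suc t)" for t
    using periodic_mod[OF perd, of "Suc t"] periodic_mod[OF perd, of "Suc (t mod n)"] by (simp add: mod_Suc_eq)
  ultimately have shift: "d (Suc t) i = d t (Suc i)" for t i
    using periodic_mod[OF perd, of t] n by (metis mod_less_divisor)
  have shifts: "d (t + k) i = d t (i + k)" for t k i
    by (induction k arbitrary: i) (simp_all add: shift)
  have "d t i = 0" for t i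
  proof -
    define k where "k = n * max H K"
    have "d t i = d (t + k) i"
      using periodic_mod[OF perd, of t] periodic_mod[OF perd, of "t + k"] by (simp add: k_def)
    also have "\<dots> = d t (i + k)" by (rule shifts)
    also have "max H K \<le> k" using n by (cases n) (auto simp: k_def)
    then have "d t (i + k) = 0" using supf supg by (simp add: d_def)
    finally show ?thesis .
  qed
  then show ?thesis by (simp add: d_def fun_eq_iff)
qed

text \<open>The state is rebuilt from past throws. The landing condition of a siteswap makes
  \<open>f t 0\<close> the number of balls thrown, which gives conservation; the total height then
  fixes the number of balls.\<close>

lemma siteswap_of_surj:
  assumes n: "0 < n" and M: "M \<in> siteswaps b \<kappa> n"
  shows "\<exists>f \<in> state_seqs b \<kappa>. periodic n f \<and> siteswap_of n f = M"
proof -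
  \<comment> \<open>The heights over one period add up to \<open>b * n\<close>, so \<open>H\<close>
    bounds every single height.\<close>
  define H where "H = b * n"
  define N where "N = n * H"
  have HN: "H \<le> N" using n by (cases n) (auto simp: N_def)
  \<comment> \<open>Collect the earlier throws landing at beat \<open>t + i\<close>; the multiple \<open>N\<close> of \<open>n\<close> keeps the subtraction from truncating.\<close>
  define f where "f t i = (\<Sum>j\<in>{i..<H}. count (M ((t + i + N - Suc j) mod n)) (Suc j))" for t i
  have mss: "is_mss n M" and balls: "(\<Sum>t<n. sum_mset (M t)) = b * n" and le\<kappa>: "\<And>t. t < n \<Longrightarrow> size (M t) \<le> \<kappa>"
    using M by (auto simp: siteswaps_def mss_balls_def)
  have set: "set_mset (M t) \<subseteq> {1..H}" if "t < n" for t
  proof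
    fix h assume h: "h \<in># M t"
    then have "0 < h" using mss that by (auto simp: is_mss_def)
    moreover have "h \<le> sum_mset (M t)" using h by (metis mset_add sum_mset.add_mset le_add1)
    moreover have "sum_mset (M t) \<le> (\<Sum>t<n. sum_mset (M t))" using that by (intro member_le_sum) auto
    ultimately show "h \<in> {1..H}" using balls by (simp add: H_def)
  qed
  have sup: "f t i = 0" if "H \<le> i" for t i using that by (simp add: f_def)
  \<comment> \<open>The summand with \<open>j = i\<close> is the throw made at beat \<open>t\<close>
    itself; the remaining ones form \<open>f t (Suc i)\<close>.\<close>
  have rec: "f (Suc t) i = f t (Suc i) + count (M (t mod n)) (Suc i)" for t i
  proof (cases "i < H")
    case True
    then have "f (Suc t) i = count (M ((Suc t + i + N - Suc i) mod n)) (Suc i) + f t (Suc i)"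
      by (simp add: f_def sum.atLeast_Suc_lessThan)
    then show ?thesis by (simp add: N_def)
  next
    case False
    then have "Suc i \<notin># M (t mod n)" using set[of "t mod n"] n by auto
    then show ?thesis using False sup by (simp add: not_in_iff)
  qed
  have per: "periodic n f"
    unfolding periodic_def f_def fun_eq_iff
  proof (intro allI sum.cong refl)
    fix t i j assume "j \<in> {i..<H}"
    then have "t + n + i + N - Suc j = (t + i + N - Suc j) + n" using HN by auto
    then show "count (M ((t + n + i + N - Suc j) mod n)) (Suc j) = count (M ((t + i + N - Suc j) mod n)) (Suc j)"
      by simp
  qed
  have f0: "f t 0 = size (M (t mod n))" for t
  proof -
    have "size (M (t mod n)) = (\<Sum>s<n. size (filter_mset (\<lambda>h. (s + h) mod n = t mod n) (M s)))"
      using mss n by (simp add: is_mss_def)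
    also have "\<dots> = (\<Sum>i<H. count (M ((t mod n + N - Suc i) mod n)) (Suc i))"
      by (rule sum_landings) (use set n HN in \<open>auto simp: N_def\<close>)
    also have "\<dots> = f t 0"
      unfolding f_def atLeast0LessThan
    proof (intro sum.cong refl)
      fix i assume "i \<in> {..<H}"
      then have "t mod n + N - Suc i = t mod n + (N - Suc i)" "t + 0 + N - Suc i = t + (N - Suc i)"
        using HN by auto
      then show "count (M ((t mod n + N - Suc i) mod n)) (Suc i) = count (M ((t + 0 + N - Suc i) mod n)) (Suc i)"
        by (simp only: mod_add_left_eq)
    qed
    finally show ?thesis by simp
  qed
  have le: "f t (Suc i) \<le> f (Suc t) i" for t i by (simp add: rec)
  have const: "(\<Sum>i<H. f t i) = (\<Sum>i<H. f 0 i)" for t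
  proof (induction t)
    case (Suc t)
    have "(\<Sum>i<H. f (Suc t) i) = (\<Sum>i<H. f t (Suc i)) + size (M (t mod n))"
      using size_eq_sum_count[OF set, of "t mod n"] n by (simp add: rec sum.distrib)
    also have "\<dots> = (\<Sum>i<Suc H. f t i)" using f0[of t] by (simp only: sum.lessThan_Suc_shift add.commute)
    also have "\<dots> = (\<Sum>i<H. f t i)" using sup by simp
    finally show ?case using Suc by simp
  qed simp
  \<comment> \<open>The state sum is already constant in \<open>t\<close>; comparing total heights
    over one period identifies it as \<open>b\<close>.\<close>
  have "(\<Sum>t<n. sum_mset (M t)) = (\<Sum>t<n. \<Sum>i<H. (f (Suc t) i - f t (Suc i)) * Suc i)"
    using sum_mset_eq_sum_count[OF set, of _ "\<lambda>h. h"] by (intro sum.cong) (simp_all add: rec)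
  also have "\<dots> = (\<Sum>t<n. \<Sum>i<H. f t i)" by (rule sum_throw_heights[OF per sup le])
  also have "\<dots> = (\<Sum>t<n. \<Sum>i<H. f 0 i)" by (intro sum.cong refl const)
  finally have "(\<Sum>i<H. f t i) = b" for t using balls n const[of t] by simp
  moreover have "f t 0 \<le> \<kappa>" for t using f0 le\<kappa> n by simp
  ultimately have "f \<in> state_seqs b \<kappa>" using sup le unfolding state_seqs_def by blast
  moreover have "siteswap_of n f = M"
  proof (rule ext, rule multiset_eqI)
    fix t h
    show "count (siteswap_of n f t) h = count (M t) h"
    proof (cases "t < n")
      case True
      then have "0 \<notin># M t" using mss by (auto simp: is_mss_def)
      then show ?thesis
        using True count_throws[of H "f (Suc t)" "f t" h] sup rec[of t "h - 1"]
        by (cases h) (simp_all add: siteswap_of_def not_in_iff)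
    qed (use mss in \<open>simp add: siteswap_of_def is_mss_def\<close>)
  qed
  ultimately show ?thesis using per by blast
qed

lemma bij_betw_siteswap_of:
  assumes "0 < n"
  shows "bij_betw (siteswap_of n) {f \<in> state_seqs b \<kappa>. periodic n f} (siteswaps b \<kappa> n)"
  unfolding bij_betw_def
proof
  show "inj_on (siteswap_of n) {f \<in> state_seqs b \<kappa>. periodic n f}"
    using siteswap_of_inj[OF assms] by (auto simp: inj_on_def)
  show "siteswap_of n ` {f \<in> state_seqs b \<kappa>. periodic n f} = siteswaps b \<kappa> n"
    using siteswap_of_mem siteswap_of_surj[OF assms] by fast
qed

lemma siteswap_of_shift:
  assumes "periodic n f"
  shows "siteswap_of n (\<lambda>t. f (t + k)) = rot n k (siteswap_of n f)"
proof
  fix t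
  have "f (Suc ((t + k) mod n)) = f (Suc (t + k))"
    using periodic_mod[OF assms, of "Suc (t + k)"] periodic_mod[OF assms, of "Suc ((t + k) mod n)"]
    by (simp add: mod_Suc_eq)
  then show "siteswap_of n (\<lambda>t. f (t + k)) t = rot n k (siteswap_of n f) t"
    using periodic_mod[OF assms, of "t + k"] by (simp add: siteswap_of_def rot_def)
qed

section \<open>Moebius inversion and rotation orbits\<close>

lemma moebius_prime_mult:
  assumes "prime p" "0 < e"
  shows "moebius (p * e) = (if p dvd e then 0 else - moebius e)"
proof (cases "p dvd e")
  case True
  then have "p\<^sup>2 dvd p * e" by (simp add: power2_eq_square)
  moreover have "\<not> is_unit p" using assms(1) by auto
  ultimately have "\<not> squarefree (p * e)" unfolding squarefree_def by blast
  then show ?thesis using True by (simp add: moebius_def)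
next
  case False
  then have "coprime p e" using assms(1) by (simp add: prime_imp_coprime)
  then have "squarefree (p * e) \<longleftrightarrow> squarefree e"
    using assms(1) by (auto simp: squarefree_mult_coprime squarefree_prime dest: squarefree_multD)
  moreover have "prime_factors (p * e) = insert p (prime_factors e)"
    using assms by (simp add: prime_factors_product prime_prime_factors)
  moreover have "p \<notin> prime_factors e" using False by auto
  ultimately show ?thesis using False assms by (simp add: moebius_def)
qed

text \<open>For a prime \<open>p\<close> dividing \<open>m\<close>, each divisor \<open>e\<close>
  prime to \<open>p\<close> cancels against \<open>p * e\<close>; all other divisors are divisible
  by the square of \<open>p\<close> and contribute 0.\<close>

lemma sum_moebius_divisors:
  assumes "0 < m"
  shows "(\<Sum>d | d dvd m. moebius d) = (if m = 1 then 1 else 0)"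
proof (cases "m = 1")
  case True
  then show ?thesis by (simp add: moebius_def)
next
  case False
  then obtain p where p: "prime p" "p dvd m" using prime_factor_nat by blast
  have fin: "finite {d. d dvd m}" using assms by simp
  let ?A = "{e. e dvd m \<and> \<not> p dvd e}"
  have pe: "p * e dvd m" if "e \<in> ?A" for e
    using that p by (intro divides_mult) (auto simp: prime_imp_coprime)
  have "{d. d dvd m} = ?A \<union> {d. d dvd m \<and> p dvd d}" by auto
  moreover have "sum moebius (?A \<union> {d. d dvd m \<and> p dvd d}) =
      (\<Sum>d\<in>?A. moebius d) + (\<Sum>d | d dvd m \<and> p dvd d. moebius d)"
    by (rule sum.union_disjoint) (use fin in auto)
  ultimately have "(\<Sum>d | d dvd m. moebius d) =
      (\<Sum>d\<in>?A. moebius d) + (\<Sum>d | d dvd m \<and> p dvd d. moebius d)"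
    by (simp only:)
  also have "(\<Sum>d | d dvd m \<and> p dvd d. moebius d) = (\<Sum>d\<in>(*) p ` ?A. moebius d)"
  proof (rule sum.mono_neutral_right)
    show "(*) p ` ?A \<subseteq> {d. d dvd m \<and> p dvd d}" by (intro image_subsetI) (simp add: pe)
    show "\<forall>d\<in>{d. d dvd m \<and> p dvd d} - (*) p ` ?A. moebius d = 0"
    proof
      fix d assume d: "d \<in> {d. d dvd m \<and> p dvd d} - (*) p ` ?A"
      then have "p dvd d" "d dvd m" by simp_all
      then obtain e where e: "d = p * e" by (elim dvdE)
      have "e dvd m" using \<open>d dvd m\<close> e by (simp add: dvd_mult_right)
      moreover from this have "0 < e" using assms by (simp add: dvd_pos_nat)
      moreover have "p dvd e" using d e \<open>e dvd m\<close> by blast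
      ultimately show "moebius d = 0" using moebius_prime_mult[OF p(1)] e by simp
    qed
  qed (use fin in auto)
  also have "\<dots> = (\<Sum>e\<in>?A. moebius (p * e))"
    using prime_gt_0_nat[OF p(1)] by (subst sum.reindex) (auto simp: inj_on_def)
  also have "\<dots> = (\<Sum>e\<in>?A. - moebius e)"
    by (intro sum.cong refl) (use assms moebius_prime_mult[OF p(1)] in \<open>auto simp: dvd_pos_nat\<close>)
  finally show ?thesis using False by (simp add: sum_negf)
qed

lemma moebius_inversion:
  fixes g h :: "nat \<Rightarrow> int"
  assumes "\<And>m. 0 < m \<Longrightarrow> g m = (\<Sum>d | d dvd m. h d)" "0 < n"
  shows "h n = (\<Sum>d | d dvd n. moebius (n div d) * g d)"
proof -
  have fin: "finite {d. d dvd n}" using assms(2) by simp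
  have "(\<Sum>d | d dvd n. moebius (n div d) * g d) =
      (\<Sum>d | d dvd n. \<Sum>e | e dvd n \<and> e dvd d. moebius (n div d) * h e)"
  proof (intro sum.cong refl)
    fix d assume d: "d \<in> {d. d dvd n}"
    then have "0 < d" using assms(2) by (auto simp: dvd_pos_nat)
    moreover have "{e. e dvd d} = {e. e dvd n \<and> e dvd d}" using d dvd_trans by auto
    ultimately show "moebius (n div d) * g d = (\<Sum>e | e dvd n \<and> e dvd d. moebius (n div d) * h e)"
      using assms(1) by (simp add: sum_distrib_left)
  qed
  also have "\<dots> = (\<Sum>e | e dvd n. \<Sum>d | d dvd n \<and> e dvd d. moebius (n div d) * h e)"
    using sum.swap_restrict[OF fin fin, of "\<lambda>d e. moebius (n div d) * h e" "\<lambda>d e. e dvd d"] by simp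
  also have "\<dots> = (\<Sum>e | e dvd n. if e = n then h e else 0)"
  proof (intro sum.cong refl)
    fix e assume "e \<in> {d. d dvd n}"
    then have e: "e dvd n" by simp
    have pos: "0 < n div e" "0 < e" using e assms(2) by (auto simp: dvd_pos_nat elim!: dvdE)
    \<comment> \<open>Complementary divisors: a divisor \<open>d\<close> of \<open>n\<close> is a
      multiple of \<open>e\<close> exactly when \<open>n div d\<close> divides
      \<open>n div e\<close>.\<close>
    have "(\<Sum>d | d dvd n \<and> e dvd d. moebius (n div d)) = (\<Sum>k | k dvd n div e. moebius k)"
    proof (rule sum.reindex_bij_witness[of _ "\<lambda>k. n div k" "\<lambda>d. n div d"])
      fix d assume "d \<in> {d. d dvd n \<and> e dvd d}"
      then obtain k l where "n = d * k" "d = e * l" by (auto elim!: dvdE)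
      then show "n div (n div d) = d" "n div d \<in> {k. k dvd n div e}" using assms(2) pos by auto
    next
      fix k assume "k \<in> {k. k dvd n div e}"
      then obtain l where "n div e = k * l" by auto
      then have "n = e * (k * l)" using e by (metis dvd_mult_div_cancel)
      then have "n = k * (e * l)" "0 < k" using assms(2) by auto
      then show "n div (n div k) = k" "n div k \<in> {d. d dvd n \<and> e dvd d}" using assms(2) by auto
    qed simp
    also have "\<dots> = (if e = n then 1 else 0)"
      using sum_moebius_divisors[OF pos(1)] e pos assms(2) by (auto elim!: dvdE)
    finally show "(\<Sum>d | d dvd n \<and> e dvd d. moebius (n div d) * h e) = (if e = n then h e else 0)"
      by (simp add: sum_distrib_right[symmetric])
  qed
  also have "\<dots> = h n" using fin by simp
  finally show ?thesis by simp
qed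

section \<open>Primitive periods\<close>

definition primitive :: "nat \<Rightarrow> (nat \<Rightarrow> 'a) \<Rightarrow> bool" where
  "primitive n f \<longleftrightarrow> periodic n f \<and> (\<forall>d. 1 \<le> d \<and> d < n \<longrightarrow> \<not> periodic d f)"

lemma periodic_mult:
  assumes "periodic d f" "d dvd n"
  shows "periodic n f"
proof -
  have "(t + n) mod d = t mod d" for t using assms(2) by (auto elim!: dvdE)
  then have "f (t + n) = f t" for t
    using periodic_mod[OF assms(1), of "t + n"] periodic_mod[OF assms(1), of t] by simp
  then show ?thesis by (simp add: periodic_def)
qed

text \<open>Otherwise the remainder \<open>n mod d\<close> would be a smaller positive
  period.\<close>

lemma primitive_dvd:
  assumes "periodic n f" "primitive d f" "0 < d"
  shows "d dvd n"
proof (rule ccontr)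
  assume "\<not> d dvd n"
  then have r: "1 \<le> n mod d" "n mod d < d" using assms(3) by (auto simp: dvd_eq_mod_eq_0 Suc_le_eq)
  have per: "periodic d f" using assms(2) by (simp add: primitive_def)
  have "f (t + n mod d) = f t" for t
  proof -
    have "f (t + n mod d) = f (t + n)"
      using periodic_mod[OF per, of "t + n mod d"] periodic_mod[OF per, of "t + n"]
      by (simp add: mod_add_right_eq)
    then show ?thesis using assms(1) by (simp add: periodic_def)
  qed
  then have "periodic (n mod d) f" by (simp add: periodic_def)
  then show False using r assms(2) by (simp add: primitive_def)
qed

lemma exists_primitive:
  assumes "periodic n f" "0 < n"
  shows "\<exists>d. 0 < d \<and> primitive d f"
proof -
  define d where "d = (LEAST d. 0 < d \<and> periodic d f)"
  have "0 < d \<and> periodic d f" unfolding d_def by (rule LeastI[of _ n]) (use assms in simp)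
  moreover have "\<not> periodic e f" if "1 \<le> e" "e < d" for e
    using not_less_Least[of e "\<lambda>d. 0 < d \<and> periodic d f"] that by (auto simp: d_def)
  ultimately show ?thesis unfolding primitive_def by blast
qed

text \<open>Each sequence of period \<open>n\<close> has exactly one positive primitive period, and
  that divides \<open>n\<close>.\<close>

lemma card_periodic:
  assumes "0 < n" "finite {f \<in> Q. periodic n f}"
  shows "card {f \<in> Q. periodic n f} = (\<Sum>d | d dvd n. card {f \<in> Q. primitive d f})"
proof -
  have "{f \<in> Q. periodic n f} = (\<Union>d\<in>{d. d dvd n}. {f \<in> Q. primitive d f})"
    using exists_primitive[OF _ assms(1)] primitive_dvd periodic_mult by (auto simp: primitive_def) blast
  moreover have "card (\<Union>d\<in>{d. d dvd n}. {f \<in> Q. primitive d f}) = (\<Sum>d | d dvd n. card {f \<in> Q. primitive d f})"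
  proof (rule card_UN_disjoint)
    show "\<forall>d\<in>{d. d dvd n}. finite {f \<in> Q. primitive d f}"
      using assms(2) calculation by (auto intro: finite_subset[rotated])
    show "\<forall>d\<in>{d. d dvd n}. \<forall>e\<in>{d. d dvd n}. d \<noteq> e \<longrightarrow>
        {f \<in> Q. primitive d f} \<inter> {f \<in> Q. primitive e f} = {}"
      using assms(1) primitive_dvd unfolding primitive_def
      by (auto simp: dvd_pos_nat) (metis Suc_leI dvd_pos_nat linorder_neqE_nat)+
  qed (use assms(1) in simp)
  ultimately show ?thesis by simp
qed

section \<open>Shifts and rotation orbits\<close>

lemma periodic_shift:
  assumes "periodic n f"
  shows "periodic n (\<lambda>t. f (t + k))"
proof -
  have "f (t + n + k) = f (t + k)" for t
    using assms[unfolded periodic_def, rule_format, of "t + k"] by (simp only: add.assoc add.commute[of k n])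
  then show ?thesis by (simp add: periodic_def)
qed

lemma shift_state_seqs:
  assumes "f \<in> state_seqs b \<kappa>"
  shows "(\<lambda>t. f (t + k)) \<in> state_seqs b \<kappa>"
proof -
  obtain H where H: "\<forall>t. (\<forall>i\<ge>H. f t i = 0) \<and> (\<Sum>i<H. f t i) = b"
    using state_seqsD(1)[OF assms] by blast
  show ?thesis
    unfolding state_seqs_def
    using state_seqsD(2,3)[OF assms] by (auto intro!: exI[of _ H] simp: H[rule_format])
qed

text \<open>Times are natural numbers, so a shift by \<open>k\<close> is undone by the further
  forward shift by \<open>n * k - k\<close>.\<close>

lemma shift_inverse:
  assumes "periodic n f" "0 < n"
  shows "f (t + (n * k - k) + k) = f t"
proof -
  have "t + (n * k - k) + k = t + n * k" using assms(2) by (cases n) auto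
  then have "f (t + (n * k - k) + k) = f (t + n * k)" by (simp only:)
  also have "\<dots> = f t"
    using periodic_mod[OF assms(1), of "t + n * k"] periodic_mod[OF assms(1), of t] by simp
  finally show ?thesis .
qed

lemma periodic_shift_iff:
  assumes "periodic n f" "0 < n"
  shows "periodic d (\<lambda>t. f (t + k)) \<longleftrightarrow> periodic d f"
proof
  assume "periodic d (\<lambda>t. f (t + k))"
  then have "periodic d (\<lambda>t. f (t + (n * k - k) + k))"
    using periodic_shift[of d "\<lambda>t. f (t + k)" "n * k - k"] by simp
  then show "periodic d f" by (simp only: shift_inverse[OF assms])
qed (rule periodic_shift)

text \<open>A rotation fixes the siteswap exactly when the corresponding shift fixes
  \<open>f\<close>, by injectivity of \<open>siteswap_of n\<close> on periodic state
  sequences.\<close>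

lemma min_period_is_siteswap_of:
  assumes "f \<in> state_seqs b \<kappa>" "periodic n f" "0 < n"
  shows "min_period_is n (siteswap_of n f) \<longleftrightarrow> primitive n f"
proof -
  have "(\<forall>t<n. siteswap_of n f ((t + d) mod n) = siteswap_of n f t) \<longleftrightarrow> periodic d f" for d
  proof -
    have "(\<forall>t<n. siteswap_of n f ((t + d) mod n) = siteswap_of n f t) \<longleftrightarrow>
        rot n d (siteswap_of n f) = siteswap_of n f"
      by (auto simp: rot_def fun_eq_iff siteswap_of_def)
    also have "\<dots> \<longleftrightarrow> siteswap_of n (\<lambda>t. f (t + d)) = siteswap_of n f"
      by (simp only: siteswap_of_shift[OF assms(2)])
    also have "\<dots> \<longleftrightarrow> (\<lambda>t. f (t + d)) = f"
      using siteswap_of_inj[OF assms(3) shift_state_seqs[OF assms(1)] periodic_shift[OF assms(2)] assms(1,2)]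
      by metis
    finally show ?thesis by (simp add: periodic_def fun_eq_iff)
  qed
  then show ?thesis using assms(2) by (simp add: min_period_is_def primitive_def)
qed

text \<open>Admitting all shifts instead of those below \<open>n\<close> allows shifts to be added
  without reduction when orbits are compared.\<close>

lemma rot_orbit_siteswap_of:
  assumes "periodic n f" "0 < n"
  shows "rot_orbit n (siteswap_of n f) = range (\<lambda>k. siteswap_of n (\<lambda>t. f (t + k)))"
proof -
  have "siteswap_of n (\<lambda>t. f (t + k)) = rot n (k mod n) (siteswap_of n f)" for k
  proof -
    have "f (t + k mod n) = f (t + k)" for t
      using periodic_mod[OF assms(1), of "t + k mod n"] periodic_mod[OF assms(1), of "t + k"]
      by (simp add: mod_add_right_eq)
    then show ?thesis using siteswap_of_shift[OF assms(1), of "k mod n"] by simp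
  qed
  moreover have "k mod n < n" for k using assms(2) by simp
  ultimately show ?thesis
    unfolding rot_orbit_def by (auto simp: siteswap_of_shift[OF assms(1)] image_iff)
qed

text \<open>Two equal rotations by \<open>k < l < n\<close> would give \<open>f\<close> the period
  \<open>l - k\<close>, against primitivity.\<close>

lemma card_rot_orbit:
  assumes "f \<in> state_seqs b \<kappa>" "primitive n f" "0 < n"
  shows "card (rot_orbit n (siteswap_of n f)) = n"
proof -
  have per: "periodic n f" using assms(2) by (simp add: primitive_def)
  have ne: "siteswap_of n (\<lambda>t. f (t + k)) \<noteq> siteswap_of n (\<lambda>t. f (t + l))" if "k < l" "l < n" for k l
  proof
    assume "siteswap_of n (\<lambda>t. f (t + k)) = siteswap_of n (\<lambda>t. f (t + l))"
    then have "(\<lambda>t. f (t + k)) = (\<lambda>t. f (t + l))"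
      using siteswap_of_inj[OF assms(3) shift_state_seqs[OF assms(1)] periodic_shift[OF per]
          shift_state_seqs[OF assms(1)] periodic_shift[OF per]] by blast
    then have "periodic (l - k) (\<lambda>t. f (t + k))" using that by (simp add: periodic_def fun_eq_iff)
    then have "periodic (l - k) f" using periodic_shift_iff[OF per assms(3)] by simp
    moreover have "1 \<le> l - k" "l - k < n" using that by auto
    ultimately show False using assms(2) unfolding primitive_def by blast
  qed
  have "inj_on (\<lambda>k. siteswap_of n (\<lambda>t. f (t + k))) {..<n}"
  proof (rule inj_onI)
    fix k l assume "k \<in> {..<n}" "l \<in> {..<n}"
      and "siteswap_of n (\<lambda>t. f (t + k)) = siteswap_of n (\<lambda>t. f (t + l))"
    then show "k = l" using ne[of k l] ne[of l k] by (cases k l rule: linorder_cases) auto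
  qed
  moreover have "rot_orbit n (siteswap_of n f) = (\<lambda>k. siteswap_of n (\<lambda>t. f (t + k))) ` {..<n}"
    unfolding rot_orbit_def siteswap_of_shift[OF per] by auto
  ultimately show ?thesis by (simp add: card_image)
qed

text \<open>From a common element, undoing the shift of \<open>f\<close> exhibits every shift of
  \<open>f\<close> as a shift of \<open>g\<close>. Used in both directions, this makes orbits equal
  or disjoint.\<close>

lemma rot_orbit_subset:
  assumes f: "f \<in> state_seqs b \<kappa>" "periodic n f" and g: "g \<in> state_seqs b \<kappa>" "periodic n g" and n: "0 < n"
    and M: "M \<in> rot_orbit n (siteswap_of n f)" "M \<in> rot_orbit n (siteswap_of n g)"
  shows "rot_orbit n (siteswap_of n f) \<subseteq> rot_orbit n (siteswap_of n g)"
proof -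
  obtain k l where "siteswap_of n (\<lambda>t. f (t + k)) = siteswap_of n (\<lambda>t. g (t + l))"
    using M rot_orbit_siteswap_of[OF f(2) n] rot_orbit_siteswap_of[OF g(2) n] by auto
  then have eq: "(\<lambda>t. f (t + k)) = (\<lambda>t. g (t + l))"
    using siteswap_of_inj[OF n shift_state_seqs[OF f(1)] periodic_shift[OF f(2)]
        shift_state_seqs[OF g(1)] periodic_shift[OF g(2)]] by blast
  have "f (t + j) = g (t + (j + (n * k - k) + l))" for t j
    using fun_cong[OF eq, of "t + j + (n * k - k)"] shift_inverse[OF f(2) n, of "t + j" k]
    by (simp add: add.assoc)
  then show ?thesis
    unfolding rot_orbit_siteswap_of[OF f(2) n] rot_orbit_siteswap_of[OF g(2) n] by auto
qed

text \<open>The patterns partition the siteswaps of minimal period \<open>n\<close> into orbits of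
  size \<open>n\<close>, and these siteswaps are the images of the primitive state
  sequences.\<close>

lemma jp_times_period:
  assumes n: "0 < n" and fin: "finite {f \<in> state_seqs b \<kappa>. periodic n f}"
  shows "n * jp b \<kappa> n = card {f \<in> state_seqs b \<kappa>. primitive n f}"
proof -
  let ?R = "{f \<in> state_seqs b \<kappa>. primitive n f}"
  let ?K = "{f \<in> state_seqs b \<kappa>. periodic n f}"
  have RK: "?R \<subseteq> ?K" by (auto simp: primitive_def)
  have P: "{M \<in> siteswaps b \<kappa> n. min_period_is n M} = siteswap_of n ` ?R"
  proof -
    have "siteswaps b \<kappa> n = siteswap_of n ` ?K"
      using bij_betw_siteswap_of[OF n] by (simp add: bij_betw_def)
    then show ?thesis using RK min_period_is_siteswap_of[OF _ _ n] by auto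
  qed
  have jp: "juggling_patterns b \<kappa> n = (\<lambda>f. rot_orbit n (siteswap_of n f)) ` ?R"
    unfolding juggling_patterns_def P by (simp add: image_image)
  have orbit: "rot_orbit n (siteswap_of n f) \<subseteq> siteswap_of n ` ?R" if f: "f \<in> ?R" for f
  proof -
    have per: "periodic n f" using f RK by auto
    have "(\<lambda>t. f (t + k)) \<in> ?R" for k
      using f shift_state_seqs periodic_shift_iff[OF per n] by (auto simp: primitive_def)
    then show ?thesis unfolding rot_orbit_siteswap_of[OF per n] by auto
  qed
  have "siteswap_of n f \<in> rot_orbit n (siteswap_of n f)" if "f \<in> ?R" for f
  proof -
    have "periodic n f" using that RK by auto
    then have "rot_orbit n (siteswap_of n f) = range (\<lambda>k. siteswap_of n (\<lambda>t. f (t + k)))"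
      by (rule rot_orbit_siteswap_of[OF _ n])
    then show ?thesis using rangeI[of "\<lambda>k. siteswap_of n (\<lambda>t. f (t + k))" 0] by simp
  qed
  then have Un: "\<Union> (juggling_patterns b \<kappa> n) = siteswap_of n ` ?R"
    unfolding jp using orbit by blast
  have finR: "finite ?R" using fin RK by (rule finite_subset[rotated])
  have "n * card (juggling_patterns b \<kappa> n) = card (\<Union> (juggling_patterns b \<kappa> n))"
  proof (rule card_partition)
    show "finite (juggling_patterns b \<kappa> n)" using finR by (simp add: jp)
    show "finite (\<Union> (juggling_patterns b \<kappa> n))" using finR by (simp add: Un)
    show "card c = n" if "c \<in> juggling_patterns b \<kappa> n" for c
      using that card_rot_orbit[OF _ _ n] by (auto simp: jp)
    fix c d assume "c \<in> juggling_patterns b \<kappa> n" "d \<in> juggling_patterns b \<kappa> n" "c \<noteq> d"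
    then obtain f g where f: "f \<in> ?K" "c = rot_orbit n (siteswap_of n f)"
      and g: "g \<in> ?K" "d = rot_orbit n (siteswap_of n g)" using RK unfolding jp by blast
    show "c \<inter> d = {}"
    proof (rule ccontr)
      assume "c \<inter> d \<noteq> {}"
      then obtain M where "M \<in> c" "M \<in> d" by blast
      moreover from this have "c \<subseteq> d" using rot_orbit_subset[of f b \<kappa> n g M] n f g by simp
      ultimately have "c = d" using rot_orbit_subset[of g b \<kappa> n f M] n f g by blast
      then show False using \<open>c \<noteq> d\<close> by blast
    qed
  qed
  also have "\<dots> = card ?R"
    unfolding Un using bij_betw_siteswap_of[OF n, of b \<kappa>] RK
    by (intro card_image) (auto simp: bij_betw_def intro: inj_on_subset)
  finally show ?thesis by (simp add: jp_def)
qed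

section \<open>Combining the counts\<close>

lemma finite_periodic_states:
  assumes "0 < n"
  shows "finite {f \<in> state_seqs b \<kappa>. periodic n f}"
proof -
  have "finite (full_walks b \<kappa> n)"
    using finite_closed_walks[OF assms finite_ord_partitions_bd, of steps b \<kappa>] finite_steps
    by (simp add: full_walks_def)
  then show ?thesis using bij_betw_finite[OF bij_betw_walk_of[OF assms]] by blast
qed

lemma ss_eq_card_states:
  assumes "0 < n"
  shows "ss b \<kappa> n = card {f \<in> state_seqs b \<kappa>. periodic n f}"
  using bij_betw_same_card[OF bij_betw_siteswap_of[OF assms]] by (simp add: ss_def)

text \<open>Periodic state sequences mediate: they are in bijection with siteswaps and with full
  walks.\<close>

lemma ss_eq_trace:
  assumes "0 < n"
  shows "int (ss b \<kappa> n) = mat_trace (card_matrix b \<kappa> ^\<^sub>m n)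
    - (\<Sum>i = b - \<kappa> ..< b. mat_trace (card_matrix i \<kappa> ^\<^sub>m n))"
  using ss_eq_card_states[OF assms] bij_betw_same_card[OF bij_betw_walk_of[OF assms, of b \<kappa>]]
    card_full_walks[OF assms, of b \<kappa>] by (simp add: mat_trace_card_matrix[OF assms])

theorem theorem12:
  fixes \<kappa> b n :: nat
  assumes "1 \<le> \<kappa>" and "1 \<le> n"
  shows "int (ss b \<kappa> n) =
           mat_trace (card_matrix b \<kappa> ^\<^sub>m n)
           - (\<Sum>i = b - \<kappa> ..< b. mat_trace (card_matrix i \<kappa> ^\<^sub>m n)) \<and>
         real (jp b \<kappa> n) =
           (1 / real n) * (\<Sum>d | d dvd n. real_of_int (moebius (n div d) *
              (mat_trace (card_matrix b \<kappa> ^\<^sub>m d)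
               - (\<Sum>i = b - \<kappa> ..< b. mat_trace (card_matrix i \<kappa> ^\<^sub>m d)))))"
proof
  have n: "0 < n" using assms(2) by simp
  show "int (ss b \<kappa> n) = mat_trace (card_matrix b \<kappa> ^\<^sub>m n)
      - (\<Sum>i = b - \<kappa> ..< b. mat_trace (card_matrix i \<kappa> ^\<^sub>m n))"
    by (rule ss_eq_trace[OF n])
  \<comment> \<open>Sorting by primitive period provides the divisor sum that Moebius inversion
    requires.\<close>
  have "int (ss b \<kappa> m) = (\<Sum>d | d dvd m. int (card {f \<in> state_seqs b \<kappa>. primitive d f}))" if "0 < m" for m
    using card_periodic[OF that finite_periodic_states[OF that]] ss_eq_card_states[OF that] by simp
  then have "int (card {f \<in> state_seqs b \<kappa>. primitive n f}) =
      (\<Sum>d | d dvd n. moebius (n div d) * int (ss b \<kappa> d))"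
    by (rule moebius_inversion[OF _ n])
  also have "\<dots> = (\<Sum>d | d dvd n. moebius (n div d) *
      (mat_trace (card_matrix b \<kappa> ^\<^sub>m d) - (\<Sum>i = b - \<kappa> ..< b. mat_trace (card_matrix i \<kappa> ^\<^sub>m d))))"
    (is "_ = ?S")
    by (intro sum.cong refl arg_cong2[where f = "(*)"] ss_eq_trace) (use n in \<open>auto simp: dvd_pos_nat\<close>)
  \<comment> \<open>The inverted count of primitive sequences is \<open>n\<close> times the number
    of patterns, which gives the factor \<open>1 / real n\<close>.\<close>
  finally have "int n * int (jp b \<kappa> n) = ?S"
    using jp_times_period[OF n finite_periodic_states[OF n], of b \<kappa>] by (metis of_nat_mult)
  then have "real n * real (jp b \<kappa> n) = real_of_int ?S"
    by (metis of_int_mult of_int_of_nat_eq)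
  then show "real (jp b \<kappa> n) =
      (1 / real n) * (\<Sum>d | d dvd n. real_of_int (moebius (n div d) *
        (mat_trace (card_matrix b \<kappa> ^\<^sub>m d)
          - (\<Sum>i = b - \<kappa> ..< b. mat_trace (card_matrix i \<kappa> ^\<^sub>m d)))))"
    using n by (simp only: of_int_sum[symmetric]) (simp add: field_simps)
qed

end
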